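(* Let $K\ge m\ge1$ be integers, $M>0$, and $\boldsymbol s=(s_1,\dots,s_m)$ a switching vector. For every $\varepsilon>0$ there exists a feasible solution $\{\theta,\lambda,\alpha^i,\beta^i\}$ of the problem $\mathrm{PoisOPTRe}_K(\boldsymbol s,M)$ with objective value $\theta\le\mathrm{PoisOPTRe}_K(\boldsymbol s,M)+\varepsilon$ such that: (i) for each $i\in[m-1]$ there is $w_i\in[0,1]$ with $\alpha^i_t=\beta^{i+1}_t$ for $t\in[0,w_i]$ and $\alpha^i_t=\beta^i_t$ for $t\in(w_i,1]$; (ii) for each $t\in[0,1]$ there is an index $r(t)\in\{1,2,\dots,m+1\}$ such that $\beta^i_t=0$ for $i\ge r(t)$ and $\beta^i_t=\lambda_t$ for $i<r(t)$.
   Context: $[n]=\{1,\dots,n\}$; $\mathrm{Pois}(c)$ is a Poisson random variable of mean $c\ge0$. A switching vector is $\boldsymbol s=(s_1,\dots,s_m)$ with integers $K=s_1>s_2>\dots>s_m>s_{m+1}:=0$. For $k\in[K]$, $i(k)\in[m]$ is the unique index with $s_{i(k)+1}<k\le s_{i(k)}$. A feasible solution of $\mathrm{PoisOPTRe}_K(\boldsymbol s,M)$ consists of $\theta\in\mathbb R$ and measurable functions $\lambda$, $\alpha^i$ ($0\le i\le m$), $\beta^i$ ($1\le i\le m$) on $[0,1]$ such that, for $t\in[0,1]$, $$\alpha_t^m=0,\quad \alpha_t^0=\lambda_t,\quad 0\le\beta^1_t\le\lambda_t\le M,\quad 0\le\beta_t^{i+1}\le\alpha_t^i\le\beta_t^i\le\lambda_t\le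 M\ (i\in[m-1]),$$ and, with $x$ solving $x_0^K=1$, $x_0^k=0$ ($k<K$), $\frac{dx_t^k}{dt}=-(y_t^k-y_t^{k+1})$, $y_t^k=\beta_t^{i(k)}x_t^k$ ($k\in[K]$), $y_t^{K+1}=0$, $$\theta\Pr\Big[\mathrm{Pois}\Big(\int_0^1\alpha_t^i\,dt\Big)\le K-1\Big]\ge\sum_{k=s_{i+1}+1}^Kx_1^k,\quad i=1,\dots,m,$$ $$\theta\,\mathbb E\Big[\min\Big\{\mathrm{Pois}\Big(\int_0^1\alpha_t^i\,dt\Big),K\Big\}\Big]\ge\sum_{k=1}^{s_{i+1}}\int_0^1\beta_t^{i(k)}x_t^k\,dt+\sum_{k=s_{i+1}+1}^K\int_0^1\alpha_t^ix_t^k\,dt,\quad i=0,\dots,m-1.$$ The objective is $\theta$, and $\mathrm{PoisOPTRe}_K(\boldsymbol s,M)$ also denotes the infimum of $\theta$ over feasible solutions. *)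

theory Defs
  imports "HOL-Probability.Probability"
begin

(* A switching vector (s_1, ..., s_m) is a function on the indices 1..m; the convention
   s_{m+1} = 0 is stored as the value at m + 1, and all other values are irrelevant. *)
definition switching_vector :: "nat \<Rightarrow> nat \<Rightarrow> (nat \<Rightarrow> nat) \<Rightarrow> bool" where
  "switching_vector K m s \<longleftrightarrow> s 1 = K \<and> (\<forall>i\<in>{1..m}. s (i + 1) < s i) \<and> s (m + 1) = 0"

definition switch_index :: "nat \<Rightarrow> (nat \<Rightarrow> nat) \<Rightarrow> nat \<Rightarrow> nat" where
  "switch_index m s k = (THE i. i \<in> {1..m} \<and> s (i + 1) < k \<and> k \<le> s i)"

(* The library distribution poisson_pmf is specified for positive means only;
   the Poisson variable of mean 0 is the constant 0. *)
definition Pois :: "real \<Rightarrow> nat pmf" where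
  "Pois c = (if c = 0 then return_pmf 0 else poisson_pmf c)"

definition flow_rate ::
  "nat \<Rightarrow> nat \<Rightarrow> (nat \<Rightarrow> nat) \<Rightarrow> (nat \<Rightarrow> real \<Rightarrow> real) \<Rightarrow> (nat \<Rightarrow> real \<Rightarrow> real) \<Rightarrow> nat \<Rightarrow> real \<Rightarrow> real" where
  "flow_rate K m s \<beta> x k t = (if k \<in> {1..K} then \<beta> (switch_index m s k) t * x k t else 0)"

(* The control \<beta> is merely measurable, so the initial value problem is understood in the
   Caratheodory sense, i.e. as an integral equation. Since \<beta> is bounded for feasible
   solutions, the integrands are Lebesgue integrable and x is uniquely determined on [0,1]. *)
definition state_solution ::
  "nat \<Rightarrow> nat \<Rightarrow> (nat \<Rightarrow> nat) \<Rightarrow> (nat \<Rightarrow> real \<Rightarrow> real) \<Rightarrow> (nat \<Rightarrow> real \<Rightarrow> real) \<Rightarrow> bool" where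
  "state_solution K m s \<beta> x \<longleftrightarrow>
     x K 0 = 1 \<and> (\<forall>k\<in>{1..<K}. x k 0 = 0) \<and>
     (\<forall>k\<in>{1..K}. \<forall>t\<in>{0..1}.
        ((\<lambda>u. - (flow_rate K m s \<beta> x k u - flow_rate K m s \<beta> x (k + 1) u))
           has_integral (x k t - x k 0)) {0..t})"

definition feasible ::
  "nat \<Rightarrow> nat \<Rightarrow> (nat \<Rightarrow> nat) \<Rightarrow> real \<Rightarrow>
   real \<Rightarrow> (real \<Rightarrow> real) \<Rightarrow> (nat \<Rightarrow> real \<Rightarrow> real) \<Rightarrow> (nat \<Rightarrow> real \<Rightarrow> real) \<Rightarrow> bool" where
  "feasible K m s M \<theta> lam \<alpha> \<beta> \<longleftrightarrow>
     lam \<in> borel_measurable (lebesgue_on {0..1}) \<and>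
     (\<forall>i\<in>{0..m}. \<alpha> i \<in> borel_measurable (lebesgue_on {0..1})) \<and>
     (\<forall>i\<in>{1..m}. \<beta> i \<in> borel_measurable (lebesgue_on {0..1})) \<and>
     (\<forall>t\<in>{0..1}.
        \<alpha> m t = 0 \<and> \<alpha> 0 t = lam t \<and>
        0 \<le> \<beta> 1 t \<and> \<beta> 1 t \<le> lam t \<and> lam t \<le> M \<and>
        (\<forall>i\<in>{1..m - 1}.
           0 \<le> \<beta> (i + 1) t \<and> \<beta> (i + 1) t \<le> \<alpha> i t \<and> \<alpha> i t \<le> \<beta> i t \<and> \<beta> i t \<le> lam t)) \<and>
     (\<exists>x. state_solution K m s \<beta> x \<and>
        (\<forall>i\<in>{1..m}.
           \<theta> * measure_pmf.prob (Pois (integral {0..1} (\<alpha> i))) {..K - 1}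
             \<ge> (\<Sum>k = s (i + 1) + 1..K. x k 1)) \<and>
        (\<forall>i\<in>{0..m - 1}.
           \<theta> * measure_pmf.expectation (Pois (integral {0..1} (\<alpha> i))) (\<lambda>n. real (min n K))
             \<ge> (\<Sum>k = 1..s (i + 1). integral {0..1} (\<lambda>t. \<beta> (switch_index m s k) t * x k t))
               + (\<Sum>k = s (i + 1) + 1..K. integral {0..1} (\<lambda>t. \<alpha> i t * x k t))))"

(* For a switching vector with m >= 1 the set of feasible objective values is nonempty
   (all controls 0 and \<theta> = 1) and bounded below by 0 (the first family of constraints with
   i = m), so Inf on the reals is the genuine infimum. *)
definition PoisOPTRe :: "nat \<Rightarrow> nat \<Rightarrow> (nat \<Rightarrow> nat) \<Rightarrow> real \<Rightarrow> real" where
  "PoisOPTRe K m s M = Inf {\<theta>. \<exists>lam \<alpha> \<beta>. feasible K m s M \<theta> lam \<alpha> \<beta>}"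

end

theory Submission
  imports Defs
begin

text \<open>
  Start from any feasible solution whose objective value exceeds the infimum by less than
  \<open>\<epsilon>/2\<close>, and change its controls twice.

  \<^emph>\<open>Chattering\<close> makes the \<open>\<beta>\<^sup>i\<close> extremal. The controls form a chain
  \<open>\<lambda> = \<alpha>\<^sup>0 \<ge> \<beta>\<^sup>1 \<ge> \<alpha>\<^sup>1 \<ge> \<beta>\<^sup>2 \<ge> \<dots> \<ge> \<alpha>\<^sup>m = 0\<close>. Cut \<open>[0,1]\<close> into \<open>N\<close> cells and let every control of the chain
  run at full rate \<open>\<lambda>\<close> from the beginning of each cell until it has delivered the integral that it had on
  this cell, and then at rate \<open>0\<close>. A smaller control stops earlier, so the chain stays ordered, and at
  each time the running controls are an initial segment of it, which is (ii). The integrals of the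
  \<open>\<alpha>\<^sup>i\<close> over \<open>[0,1]\<close>, and with them the Poisson terms, do not change at all. The new controls are
  \<open>O(1/N)\<close> close to the old ones when tested against Lipschitz functions (\<open>chatter_close\<close>); as the
  states are Lipschitz, a Gronwall argument shows that the states move by \<open>O(1/N)\<close>
  (\<open>cascade_stability\<close>), and then so do the right-hand sides of all constraints. Raising \<open>\<theta>\<close> by
  \<open>\<epsilon>/2\<close> pays for this wherever the Poisson term is positive. It vanishes only in the second
  family of constraints when \<open>\<integral>\<alpha>\<^sup>i = 0\<close>, and then the right-hand side after chattering is at
  most a multiple of \<open>\<integral>\<alpha>\<^sup>i\<close>, that is \<open>0\<close>.

  \<^emph>\<open>Late switching\<close> gives (i) and leaves the \<open>\<beta>\<^sup>i\<close>, hence the states, alone. For \<open>0 < i < m\<close> the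
  control \<open>\<alpha>\<^sup>i\<close> enters the constraints only through \<open>\<integral>\<alpha>\<^sup>i\<close> and \<open>\<integral>\<alpha>\<^sup>i X\<close>, where \<open>X\<close> is the sum of the states
  \<open>x\<^sup>k\<close> with \<open>k > s\<^sub>i\<^sub>+\<^sub>1\<close>. The state only ever moves downwards, so \<open>X\<close> is nonincreasing, and among all
  controls between \<open>\<beta>\<^sup>i\<^sup>+\<^sup>1\<close> and \<open>\<beta>\<^sup>i\<close> with a given integral the one that acts as late as possible
  minimizes \<open>\<integral>\<alpha>\<^sup>i X\<close> (\<open>late_switch_optimal\<close>).
\<close>

section \<open>Bounded measurable functions on the unit interval\<close>

text \<open>
  All controls and states of the problem lie in this class. It is closed under the operations
  used below, and its members are integrable on every subinterval, so that no
  integrability condition has to be carried along.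
\<close>

definition bdd_meas :: "(real \<Rightarrow> real) \<Rightarrow> bool" where
  "bdd_meas f \<longleftrightarrow> f \<in> borel_measurable (lebesgue_on {0..1}) \<and> (\<exists>B. \<forall>t\<in>{0..1}. \<bar>f t\<bar> \<le> B)"

lemma bdd_measI:
  assumes "f \<in> borel_measurable (lebesgue_on {0..1})" "\<And>t. t \<in> {0..1} \<Longrightarrow> \<bar>f t\<bar> \<le> B"
  shows "bdd_meas f"
  using assms unfolding bdd_meas_def by blast

lemma bdd_meas_measurable: "bdd_meas f \<Longrightarrow> f \<in> borel_measurable (lebesgue_on {0..1})"
  by (simp add: bdd_meas_def)

lemma bdd_meas_continuous:
  assumes "continuous_on {0..1} f"
  shows "bdd_meas f"
proof -
  have "f \<in> borel_measurable (lebesgue_on {0..1})"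
    by (intro continuous_imp_measurable_on_sets_lebesgue assms) auto
  moreover have "bounded (f ` {0..1})"
    using assms by (intro compact_imp_bounded compact_continuous_image) auto
  ultimately show ?thesis
    unfolding bdd_meas_def by (auto simp: bounded_iff)
qed

lemma bdd_meas_const [simp]: "bdd_meas (\<lambda>_. c)"
  by (rule bdd_meas_continuous) auto

lemma bdd_meas_add:
  assumes "bdd_meas f" "bdd_meas g"
  shows "bdd_meas (\<lambda>t. f t + g t)"
proof -
  obtain A B where "\<And>t. t \<in> {0..1} \<Longrightarrow> \<bar>f t\<bar> \<le> A" "\<And>t. t \<in> {0..1} \<Longrightarrow> \<bar>g t\<bar> \<le> B"
    using assms unfolding bdd_meas_def by blast
  then have "\<And>t. t \<in> {0..1} \<Longrightarrow> \<bar>f t + g t\<bar> \<le> A + B"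
    by (meson abs_triangle_ineq add_mono order_trans)
  then show ?thesis
    using assms by (intro bdd_measI) (auto simp: bdd_meas_def)
qed

lemma bdd_meas_mult:
  assumes "bdd_meas f" "bdd_meas g"
  shows "bdd_meas (\<lambda>t. f t * g t)"
proof -
  obtain A B where "\<And>t. t \<in> {0..1} \<Longrightarrow> \<bar>f t\<bar> \<le> A" "\<And>t. t \<in> {0..1} \<Longrightarrow> \<bar>g t\<bar> \<le> B"
    using assms unfolding bdd_meas_def by blast
  then have "\<bar>f t * g t\<bar> \<le> A * B" if "t \<in> {0..1}" for t
    using that by (auto simp: abs_mult intro!: mult_mono intro: order_trans[OF abs_ge_zero])
  then show ?thesis
    using assms by (intro bdd_measI) (auto simp: bdd_meas_def)
qed

lemma bdd_meas_diff:
  assumes "bdd_meas f" "bdd_meas g"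
  shows "bdd_meas (\<lambda>t. f t - g t)"
  using bdd_meas_add[OF assms(1) bdd_meas_mult[OF bdd_meas_const[of "-1"] assms(2)]] by simp

lemma bdd_meas_sum:
  assumes "\<And>i. i \<in> A \<Longrightarrow> bdd_meas (f i)"
  shows "bdd_meas (\<lambda>t. \<Sum>i\<in>A. f i t)"
  using assms by (induction A rule: infinite_finite_induct) (auto intro: bdd_meas_add)

lemma bdd_meas_if:
  assumes "bdd_meas f" "bdd_meas g" "S \<in> sets lebesgue"
  shows "bdd_meas (\<lambda>t. if t \<in> S then f t else g t)"
proof -
  obtain A B where "\<And>t. t \<in> {0..1} \<Longrightarrow> \<bar>f t\<bar> \<le> A" "\<And>t. t \<in> {0..1} \<Longrightarrow> \<bar>g t\<bar> \<le> B"
    using assms unfolding bdd_meas_def by blast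
  then have *: "\<And>t. t \<in> {0..1} \<Longrightarrow> \<bar>if t \<in> S then f t else g t\<bar> \<le> max A B"
    by (metis max.coboundedI1 max.coboundedI2)
  have "S \<inter> {0..1} \<in> sets (lebesgue_on {0..1})"
    using assms(3) by (auto simp: sets_restrict_space)
  then have "(\<lambda>t. if t \<in> S then f t else g t) \<in> borel_measurable (lebesgue_on {0..1})"
    using assms(1,2) unfolding bdd_meas_def
    by (intro measurable_If_set) (auto simp: Int_commute)
  with * show ?thesis
    by (rule bdd_measI[rotated])
qed

lemma bdd_meas_integrable:
  assumes "bdd_meas f" "0 \<le> a" "b \<le> 1"
  shows "f integrable_on {a..b}"
proof -
  obtain B where B: "\<And>t. t \<in> {0..1} \<Longrightarrow> \<bar>f t\<bar> \<le> B"
    using assms unfolding bdd_meas_def by blast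
  have "f integrable_on {0..1}"
    by (rule measurable_bounded_by_integrable_imp_integrable_real[OF bdd_meas_measurable[OF assms(1)],
          where g="\<lambda>_. B"]) (auto intro: B)
  then show ?thesis
    using assms by (auto intro: integrable_subinterval_real)
qed

lemma bdd_meas_indefinite_continuous:
  "bdd_meas f \<Longrightarrow> continuous_on {0..1} (\<lambda>t. integral {0..t} f)"
  by (intro indefinite_integral_continuous_1 bdd_meas_integrable) auto

lemma bdd_meas_integral_split:
  assumes "bdd_meas f" "0 \<le> a" "a \<le> b" "b \<le> c" "c \<le> 1"
  shows "integral {a..c} f = integral {a..b} f + integral {b..c} f"
  by (rule Henstock_Kurzweil_Integration.integral_combine[symmetric]) (use assms in \<open>auto intro: bdd_meas_integrable\<close>)

lemma bdd_meas_integral_abs_le: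
  assumes "bdd_meas f" "0 \<le> a" "a \<le> b" "b \<le> 1" "\<And>t. t \<in> {a..b} \<Longrightarrow> \<bar>f t\<bar> \<le> B"
  shows "\<bar>integral {a..b} f\<bar> \<le> B * (b - a)"
proof -
  have "norm (integral {a..b} f) \<le> integral {a..b} (\<lambda>_. B)"
    using assms by (intro integral_norm_bound_integral bdd_meas_integrable) auto
  then show ?thesis
    using assms by (simp add: mult.commute)
qed

section \<open>Linear integral equations with measurable coefficients\<close>

text \<open>
  In the weighted supremum norm \<open>sup \<bar>f t\<bar> exp (- 2 M t)\<close> the operator \<open>f \<mapsto> \<integral> b f\<close> has norm at most
  \<open>1/2\<close> on all of \<open>[0,1]\<close>, however large \<open>M\<close> is. This one estimate gives both the Gronwall bound and
  the convergence of the Picard iteration.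
\<close>

lemma weighted_integral_bound:
  fixes C M :: real
  assumes f: "bdd_meas f" and b: "bdd_meas b" and "0 \<le> C" "0 \<le> M"
    and bM: "\<And>u. u \<in> {0..1} \<Longrightarrow> \<bar>b u\<bar> \<le> M"
    and fC: "\<And>u. u \<in> {0..1} \<Longrightarrow> \<bar>f u\<bar> \<le> C * exp (2 * M * u)"
    and t: "t \<in> {0..1}"
  shows "\<bar>integral {0..t} (\<lambda>u. b u * f u)\<bar> \<le> C / 2 * exp (2 * M * t)"
proof -
  have I: "((\<lambda>u. M * C * exp (2 * M * u)) has_integral
      (C / 2 * exp (2 * M * t) - C / 2 * exp (2 * M * 0))) {0..t}"
    using t by (intro fundamental_theorem_of_calculus)
      (auto intro!: derivative_eq_intros simp: has_real_derivative_iff_has_vector_derivative[symmetric])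
  have "\<bar>b u * f u\<bar> \<le> M * C * exp (2 * M * u)" if "u \<in> {0..t}" for u
  proof -
    have "\<bar>b u\<bar> * \<bar>f u\<bar> \<le> M * (C * exp (2 * M * u))"
      using that t assms(3,4) by (intro mult_mono bM fC) auto
    then show ?thesis by (simp add: abs_mult mult.assoc)
  qed
  then have "norm (integral {0..t} (\<lambda>u. b u * f u)) \<le> integral {0..t} (\<lambda>u. M * C * exp (2 * M * u))"
    using t has_integral_integrable[OF I]
    by (intro integral_norm_bound_integral bdd_meas_integrable[OF bdd_meas_mult[OF b f]]) auto
  also have "\<dots> = C / 2 * exp (2 * M * t) - C / 2"
    using integral_unique[OF I] by simp
  finally show ?thesis using \<open>0 \<le> C\<close> by simp
qed

lemma gronwall_bound:
  fixes a M :: real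
  assumes d: "continuous_on {0..1} d" and b: "bdd_meas b" and "0 \<le> a" "0 \<le> M"
    and bM: "\<And>u. u \<in> {0..1} \<Longrightarrow> \<bar>b u\<bar> \<le> M"
    and le: "\<And>t. t \<in> {0..1} \<Longrightarrow> \<bar>d t\<bar> \<le> a + \<bar>integral {0..t} (\<lambda>u. b u * d u)\<bar>"
    and t: "t \<in> {0..1}"
  shows "\<bar>d t\<bar> \<le> 2 * exp (2 * M) * a"
proof -
  let ?w = "\<lambda>t. \<bar>d t\<bar> * exp (- 2 * M * t)"
  \<comment> \<open>The weighted supremum is attained at some \<open>p\<close>; at \<open>p\<close> the hypothesis bounds it by
    half of itself plus \<open>a\<close>.\<close>
  have "continuous_on {0..1} ?w"
    by (intro continuous_intros d)
  then obtain p where p: "p \<in> {0..1}" "\<And>t. t \<in> {0..1} \<Longrightarrow> ?w t \<le> ?w p"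
    using continuous_attains_sup[of "{0..1::real}" ?w] by auto
  define S where "S = ?w p"
  have dS: "\<bar>d u\<bar> \<le> S * exp (2 * M * u)" if "u \<in> {0..1}" for u
    using p(2)[OF that] unfolding S_def by (simp add: exp_minus field_simps)
  have "S \<ge> 0" by (simp add: S_def)
  have "\<bar>d p\<bar> \<le> a + S / 2 * exp (2 * M * p)"
    using le[OF p(1)] weighted_integral_bound[OF bdd_meas_continuous[OF d] b \<open>S \<ge> 0\<close> \<open>0 \<le> M\<close> bM dS p(1)]
    by linarith
  then have "S \<le> (a + S / 2 * exp (2 * M * p)) * exp (- 2 * M * p)"
    unfolding S_def by (intro mult_right_mono) auto
  also have "\<dots> = a * exp (- 2 * M * p) + S / 2"
    by (simp add: algebra_simps flip: exp_add)
  also have "\<dots> \<le> a * 1 + S / 2"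
    using p(1) \<open>0 \<le> M\<close> \<open>0 \<le> a\<close> by (intro add_mono mult_left_mono) auto
  finally have "S \<le> 2 * a" by simp
  moreover have "exp (2 * M * t) \<le> exp (2 * M)"
    using t \<open>0 \<le> M\<close> by (simp add: mult_left_le)
  ultimately have "S * exp (2 * M * t) \<le> (2 * a) * exp (2 * M)"
    using \<open>0 \<le> a\<close> by (intro mult_mono) auto
  with dS[OF t] show ?thesis by (simp add: mult_ac)
qed

text \<open>
  After the last time \<open>p\<close> at which \<open>x\<close> is nonnegative the integrand \<open>g - b x\<close> would be
  nonnegative, so \<open>x\<close> could not have become negative. This avoids the explicit solution
  formula, and with it any calculus for absolutely continuous functions.
\<close>

lemma linear_integral_equation_nonneg:
  fixes c :: real
  assumes x: "continuous_on {0..1} x" and g: "bdd_meas g" and b: "bdd_meas b"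
    and nn: "\<And>t. t \<in> {0..1} \<Longrightarrow> 0 \<le> g t" "\<And>t. t \<in> {0..1} \<Longrightarrow> 0 \<le> b t" "0 \<le> c"
    and eq: "\<And>t. t \<in> {0..1} \<Longrightarrow> x t = c + integral {0..t} (\<lambda>u. g u - b u * x u)"
    and t: "t \<in> {0..1}"
  shows "0 \<le> x t"
proof (rule ccontr)
  assume neg: "\<not> 0 \<le> x t"
  let ?h = "\<lambda>u. g u - b u * x u"
  have h: "bdd_meas ?h"
    by (intro bdd_meas_diff bdd_meas_mult g b bdd_meas_continuous x)
  define Z where "Z = {u \<in> {0..t}. x u \<in> {0..}}"
  have "continuous_on {0..t} x"
    using x by (rule continuous_on_subset) (use t in auto)
  then have "closed Z"
    unfolding Z_def using continuous_closed_preimage[of "{0..t}" x "{0..}"]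
    by (simp add: vimage_def Int_def)
  moreover have "0 \<in> Z"
    using eq[of 0] nn(3) t by (simp add: Z_def)
  moreover have "bdd_above Z"
    unfolding Z_def by (rule bdd_aboveI[of _ t]) auto
  ultimately have sZ: "Sup Z \<in> Z"
    by (intro closed_contains_Sup) auto
  define p where "p = Sup Z"
  have p: "0 \<le> p" "p < t" "0 \<le> x p"
    using sZ neg by (auto simp: Z_def p_def less_le)
  have "x u < 0" if "u \<in> {p<..<t}" for u
  proof (rule ccontr)
    assume "\<not> x u < 0"
    then have "u \<in> Z"
      using that p by (auto simp: Z_def)
    then have "u \<le> p"
      unfolding p_def using \<open>bdd_above Z\<close> by (rule cSup_upper)
    with that show False by simp
  qed
  then have "0 \<le> ?h u" if "u \<in> {p<..<t}" for u
    using that p t nn(1)[of u] nn(2)[of u] mult_nonneg_nonpos[of "b u" "x u"] by fastforce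
  moreover have "?h integrable_on {p<..<t}"
    using p t by (simp add: integrable_on_open_interval_real bdd_meas_integrable[OF h])
  ultimately have "0 \<le> integral {p<..<t} ?h"
    by (intro integral_nonneg)
  then have "0 \<le> integral {p..t} ?h"
    by (simp add: integral_open_interval_real)
  moreover have "x t = x p + integral {p..t} ?h"
    using eq[of t] eq[of p] bdd_meas_integral_split[OF h, of 0 p t] p t by simp
  ultimately show False using p neg by simp
qed

text \<open>
  Picard iteration: consecutive iterates differ by at most \<open>C / 2\<^sup>n\<close> in the weighted norm, so the
  iterates converge uniformly, and the limit is a fixed point.
\<close>

lemma linear_integral_equation_solvable:
  fixes c :: real
  assumes g: "bdd_meas g" and b: "bdd_meas b"
  obtains x where "continuous_on {0..1} x"
    "\<And>t. t \<in> {0..1} \<Longrightarrow> x t = c + integral {0..t} (\<lambda>u. g u - b u * x u)"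
proof -
  obtain M where "\<And>u. u \<in> {0..1} \<Longrightarrow> \<bar>b u\<bar> \<le> M"
    using b unfolding bdd_meas_def by blast
  then have bM: "\<And>u. u \<in> {0..1} \<Longrightarrow> \<bar>b u\<bar> \<le> M" and "0 \<le> M"
    by (auto intro: order_trans[OF abs_ge_zero, of "b 0"])
  define T where "T = (\<lambda>x t. c + integral {0..t} (\<lambda>u. g u - b u * x u))"
  define p where "p = (\<lambda>n. (T ^^ n) (\<lambda>_. c))"
  have p0: "p 0 = (\<lambda>_. c)" and pS: "p (Suc n) = T (p n)" for n
    by (simp_all add: p_def)
  have bm: "bdd_meas (\<lambda>u. g u - b u * x u)" if "continuous_on {0..1} x" for x
    by (intro bdd_meas_diff bdd_meas_mult g b bdd_meas_continuous that)
  have cont: "continuous_on {0..1} (p n)" for n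
  proof (induction n)
    case (Suc n)
    show ?case
      unfolding pS T_def by (intro continuous_intros bdd_meas_indefinite_continuous bm Suc)
  qed (simp add: p0)
  define d where "d = (\<lambda>n t. p (Suc n) t - p n t)"
  have d_cont: "continuous_on {0..1} (d n)" for n
    unfolding d_def by (intro continuous_intros cont)
  have T_diff: "T x t - T y t = - integral {0..t} (\<lambda>u. b u * (x u - y u))"
    if "continuous_on {0..1} x" "continuous_on {0..1} y" "t \<in> {0..1}" for x y t
  proof -
    have "T x t - T y t = integral {0..t} (\<lambda>u. (g u - b u * x u) - (g u - b u * y u))"
      unfolding T_def using that by (subst integral_diff) (auto intro!: bdd_meas_integrable bm)
    also have "\<dots> = integral {0..t} (\<lambda>u. - (b u * (x u - y u)))"
      by (simp add: algebra_simps)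
    finally show ?thesis by simp
  qed
  obtain C where C: "\<And>t. t \<in> {0..1} \<Longrightarrow> \<bar>d 0 t\<bar> \<le> C"
    using bdd_meas_continuous[OF d_cont[of 0]] unfolding bdd_meas_def by blast
  then have "0 \<le> C"
    using abs_ge_zero[of "d 0 0"] by (meson order_trans atLeastAtMost_iff order_refl zero_le_one)
  have d_bound: "\<bar>d n t\<bar> \<le> C / 2 ^ n * exp (2 * M * t)" if "t \<in> {0..1}" for n t
    using that
  proof (induction n arbitrary: t)
    case 0
    have "C * 1 \<le> C * exp (2 * M * t)"
      using 0 \<open>0 \<le> C\<close> \<open>0 \<le> M\<close> by (intro mult_left_mono) auto
    with C[OF 0] show ?case by simp
  next
    case (Suc n)
    have "\<bar>integral {0..t} (\<lambda>u. b u * d n u)\<bar> \<le> (C / 2 ^ n) / 2 * exp (2 * M * t)"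
      using \<open>0 \<le> C\<close> \<open>0 \<le> M\<close> Suc
      by (intro weighted_integral_bound bdd_meas_continuous d_cont b bM) auto
    moreover have "d (Suc n) t = - integral {0..t} (\<lambda>u. b u * d n u)"
      using T_diff[OF cont cont Suc.prems, of "Suc n" n] unfolding d_def pS .
    ultimately show ?case by (simp add: mult.commute)
  qed
  define x where "x = (\<lambda>t. c + (\<Sum>n. d n t))"
  have "uniform_limit {0..1} (\<lambda>n t. \<Sum>i<n. d i t) (\<lambda>t. \<Sum>n. d n t) sequentially"
  proof (rule Weierstrass_m_test[where M="\<lambda>n. C * exp (2 * M) * (1 / 2) ^ n"])
    fix n and t :: real assume t: "t \<in> {0..1}"
    have "C / 2 ^ n * exp (2 * M * t) \<le> C / 2 ^ n * exp (2 * M)"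
      using t \<open>0 \<le> C\<close> \<open>0 \<le> M\<close> by (intro mult_left_mono) (auto simp: mult_left_le)
    with d_bound[OF t, of n] show "norm (d n t) \<le> C * exp (2 * M) * (1 / 2) ^ n"
      by (simp add: power_one_over field_simps)
  qed (auto intro!: summable_mult summable_geometric)
  then have "uniform_limit {0..1} (\<lambda>n t. c + (\<Sum>i<n. d i t)) x sequentially"
    unfolding x_def by (intro uniform_limit_add uniform_limit_const)
  moreover have "c + (\<Sum>i<n. d i t) = p n t" for n t
    by (induction n) (auto simp: d_def p0)
  ultimately have lim: "uniform_limit {0..1} p x sequentially"
    by simp
  then have x_cont: "continuous_on {0..1} x"
    by (rule uniform_limit_theorem[rotated]) (auto simp: cont)
  have "x t = T x t" if t: "t \<in> {0..1}" for t
  proof (rule tendsto_unique[OF sequentially_bot])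
    show "(\<lambda>n. p (Suc n) t) \<longlonglongrightarrow> x t"
      using tendsto_uniform_limitI[OF lim t] by (rule LIMSEQ_Suc)
    show "(\<lambda>n. p (Suc n) t) \<longlonglongrightarrow> T x t"
    proof (rule LIMSEQ_I)
      fix r :: real assume "0 < r"
      define e where "e = r / (2 * (M + 1))"
      have "0 < e" using \<open>0 < r\<close> \<open>0 \<le> M\<close> by (simp add: e_def)
      then obtain N where N: "\<And>n u. n \<ge> N \<Longrightarrow> u \<in> {0..1} \<Longrightarrow> \<bar>p n u - x u\<bar> < e"
        using uniform_limitD[OF lim] unfolding eventually_sequentially dist_real_def by blast
      have "norm (p (Suc n) t - T x t) < r" if "n \<ge> N" for n
      proof -
        have "\<bar>integral {0..t} (\<lambda>u. b u * (p n u - x u))\<bar> \<le> (M * e) * (t - 0)"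
        proof (rule bdd_meas_integral_abs_le)
          show "bdd_meas (\<lambda>u. b u * (p n u - x u))"
            by (intro bdd_meas_mult bdd_meas_diff b bdd_meas_continuous cont x_cont)
          fix u assume "u \<in> {0..t}"
          with t have "u \<in> {0..1}" by auto
          then show "\<bar>b u * (p n u - x u)\<bar> \<le> M * e"
            unfolding abs_mult using N[OF that, of u] bM[of u] \<open>0 \<le> M\<close> by (intro mult_mono) auto
        qed (use t in auto)
        also have "\<dots> \<le> M * e" using t \<open>0 \<le> M\<close> \<open>0 < e\<close> by (simp add: mult_left_le)
        also have "\<dots> < r"
          using \<open>0 < r\<close> \<open>0 \<le> M\<close> by (simp add: e_def field_simps add_nonneg_pos)
        finally show ?thesis
          unfolding pS using T_diff[OF cont x_cont t, of n] by simp
      qed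
      then show "\<exists>N. \<forall>n\<ge>N. norm (p (Suc n) t - T x t) < r" by blast
    qed
  qed
  then show thesis
    using that[OF x_cont] unfolding T_def by blast
qed

section \<open>The flow through a chain of reservoirs\<close>

text \<open>
  The states \<open>x\<^sup>K, \<dots>, x\<^sup>1\<close> form a chain of reservoirs in which the one with number \<open>k\<close> drains into the
  one with number \<open>k - 1\<close> at rate \<open>b k\<close>. The dynamics see the controls and the switching vector only
  through these rates, so they are studied for arbitrary bounded measurable rates.
\<close>

definition outflow :: "nat \<Rightarrow> (nat \<Rightarrow> real \<Rightarrow> real) \<Rightarrow> (nat \<Rightarrow> real \<Rightarrow> real) \<Rightarrow> nat \<Rightarrow> real \<Rightarrow> real" where
  "outflow K b x k t = (if k \<in> {1..K} then b k t * x k t else 0)"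

locale rates =
  fixes K :: nat and M :: real and b :: "nat \<Rightarrow> real \<Rightarrow> real"
  assumes K_pos: "1 \<le> K" and M_nonneg: "0 \<le> M"
    and b_meas: "k \<in> {1..K} \<Longrightarrow> bdd_meas (b k)"
    and b_bounds: "k \<in> {1..K} \<Longrightarrow> t \<in> {0..1} \<Longrightarrow> 0 \<le> b k t \<and> b k t \<le> M"

locale cascade = rates +
  fixes x :: "nat \<Rightarrow> real \<Rightarrow> real"
  assumes init_top: "x K 0 = 1" and init_rest: "k \<in> {1..<K} \<Longrightarrow> x k 0 = 0"
    and dynamics: "k \<in> {1..K} \<Longrightarrow> t \<in> {0..1} \<Longrightarrow>
      ((\<lambda>u. - (outflow K b x k u - outflow K b x (k + 1) u)) has_integral (x k t - x k 0)) {0..t}"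

lemma (in rates) cascade_exists: "\<exists>x. cascade K M b x"
proof -
  define solves where "solves = (\<lambda>(x :: nat \<Rightarrow> real \<Rightarrow> real) k. continuous_on {0..1} (x k) \<and>
      (\<forall>t\<in>{0..1}. x k t = (if k = K then 1 else 0)
         + integral {0..t} (\<lambda>u. outflow K b x (k + 1) u - b k u * x k u)))"
  \<comment> \<open>The reservoirs are solved from the top downwards: once \<open>x (k + 1)\<close> is known, the equation for
    \<open>x k\<close> is a scalar linear one with known inflow.\<close>
  have step: "\<exists>x. \<forall>k\<in>{K + 1 - n..K}. solves x k" if "n \<le> K" for n
    using that
  proof (induction n)
    case (Suc n)
    then obtain x where x: "\<And>k. k \<in> {K + 1 - n..K} \<Longrightarrow> solves x k"
      by (metis Suc_leD)
    define j where "j = K - n"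
    have j: "j \<in> {1..K}" using Suc.prems by (auto simp: j_def)
    have "bdd_meas (outflow K b x (j + 1))"
    proof (cases "j + 1 \<le> K")
      case True
      then have "solves x (j + 1)" by (intro x) (auto simp: j_def)
      then have "bdd_meas (\<lambda>t. b (j + 1) t * x (j + 1) t)"
        using True by (intro bdd_meas_mult b_meas bdd_meas_continuous) (auto simp: solves_def)
      then show ?thesis using True by (simp add: outflow_def[abs_def])
    qed (auto simp: outflow_def[abs_def])
    then obtain z where z: "continuous_on {0..1} z"
      "\<And>t. t \<in> {0..1} \<Longrightarrow> z t = (if j = K then 1 else 0)
         + integral {0..t} (\<lambda>u. outflow K b x (j + 1) u - b j u * z u)"
      using linear_integral_equation_solvable[OF _ b_meas[OF j]] by metis
    have upd: "outflow K b (x(j := z)) (k + 1) = outflow K b x (k + 1)" if "j \<le> k" for k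
      using that by (auto simp: outflow_def)
    have "solves (x(j := z)) k" if k: "k \<in> {K + 1 - Suc n..K}" for k
    proof (cases "k = j")
      case True
      then show ?thesis
        using z upd[of j] by (simp add: solves_def)
    next
      case False
      with k have k': "k \<in> {K + 1 - n..K}" "k > j" by (auto simp: j_def)
      from x[OF k'(1)] k'(2) upd[of k] show ?thesis
        by (simp add: solves_def)
    qed
    then show ?case by blast
  qed auto
  from step[of K] obtain x where x: "\<And>k. k \<in> {1..K} \<Longrightarrow> solves x k"
    by (metis add_diff_cancel_left' order_refl)
  have x0: "x k 0 = (if k = K then 1 else 0)" if "k \<in> {1..K}" for k
    using x[OF that] by (simp add: solves_def)
  have out: "bdd_meas (outflow K b x k)" for k
  proof (cases "k \<in> {1..K}")
    case True
    then have "bdd_meas (\<lambda>t. b k t * x k t)"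
      using x[OF True] by (intro bdd_meas_mult b_meas bdd_meas_continuous) (auto simp: solves_def)
    then show ?thesis using True by (simp add: outflow_def[abs_def])
  next
    case False
    then have "outflow K b x k = (\<lambda>_. 0)" by (auto simp: outflow_def)
    then show ?thesis by simp
  qed
  have "cascade K M b x"
  proof
    fix k and t :: real assume k: "k \<in> {1..K}" and t: "t \<in> {0..1}"
    let ?h = "\<lambda>u. - (outflow K b x k u - outflow K b x (k + 1) u)"
    have "?h = (\<lambda>u. outflow K b x (k + 1) u - b k u * x k u)"
      using k by (auto simp: outflow_def)
    then have "x k t - x k 0 = integral {0..t} ?h"
      using x[OF k] t x0[OF k] by (simp add: solves_def)
    moreover have "bdd_meas (\<lambda>u. outflow K b x (k + 1) u - outflow K b x k u)"
      by (intro bdd_meas_diff out)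
    then have "?h integrable_on {0..t}"
      using bdd_meas_integrable[of ?h 0 t] t by simp
    ultimately show "(?h has_integral (x k t - x k 0)) {0..t}"
      by (simp add: has_integral_iff)
  qed (use K_pos x0 in auto)
  then show ?thesis by blast
qed

context cascade
begin

lemma x_0: "k \<in> {1..K} \<Longrightarrow> x k 0 = (if k = K then 1 else 0)"
  using init_top init_rest by auto

lemma x_continuous:
  assumes "k \<in> {1..K}"
  shows "continuous_on {0..1} (x k)"
proof -
  let ?h = "\<lambda>u. - (outflow K b x k u - outflow K b x (k + 1) u)"
  have "?h integrable_on {0..1}"
    using dynamics[OF assms, of 1] by (auto simp: integrable_on_def)
  then have "continuous_on {0..1} (\<lambda>t. x k 0 + integral {0..t} ?h)"
    by (intro continuous_intros indefinite_integral_continuous_1)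
  moreover have "x k 0 + integral {0..t} ?h = x k t" if "t \<in> {0..1}" for t
    using integral_unique[OF dynamics[OF assms that]] by simp
  ultimately show ?thesis
    by (subst continuous_on_cong[OF refl, of _ "x k"]) auto
qed

lemma x_meas: "k \<in> {1..K} \<Longrightarrow> bdd_meas (x k)"
  by (intro bdd_meas_continuous x_continuous)

lemma outflow_meas: "bdd_meas (outflow K b x k)"
proof (cases "k \<in> {1..K}")
  case True
  then have "bdd_meas (\<lambda>t. b k t * x k t)"
    by (intro bdd_meas_mult b_meas x_meas)
  then show ?thesis using True by (simp add: outflow_def[abs_def])
next
  case False
  then have "outflow K b x k = (\<lambda>_. 0)" by (auto simp: outflow_def)
  then show ?thesis by simp
qed

lemma x_eq:
  assumes "k \<in> {1..K}" "t \<in> {0..1}"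
  shows "x k t = x k 0 + (integral {0..t} (outflow K b x (k + 1)) - integral {0..t} (outflow K b x k))"
proof -
  have "integral {0..t} (\<lambda>u. outflow K b x (k + 1) u - outflow K b x k u)
      = integral {0..t} (outflow K b x (k + 1)) - integral {0..t} (outflow K b x k)"
    using assms by (intro integral_diff bdd_meas_integrable outflow_meas) auto
  with integral_unique[OF dynamics[OF assms]] show ?thesis by simp
qed

lemma x_nonneg:
  assumes "k \<in> {1..K}" "t \<in> {0..1}"
  shows "0 \<le> x k t"
proof -
  have "\<forall>k\<in>{1..K}. K - k = n \<longrightarrow> (\<forall>t\<in>{0..1}. 0 \<le> x k t)" for n
  proof (induction n rule: less_induct)
    case (less n)
    show ?case
    proof (intro ballI impI)
      fix k and t :: real assume k: "k \<in> {1..K}" "K - k = n" and t: "t \<in> {0..1}"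
      have inflow: "0 \<le> outflow K b x (k + 1) u" if "u \<in> {0..1}" for u
      proof (cases "k + 1 \<le> K")
        case True
        then have "0 \<le> x (k + 1) u"
          using less.IH[of "K - (k + 1)"] k that by auto
        then show ?thesis
          using b_bounds[of "k + 1" u] that by (auto simp: outflow_def)
      qed (simp add: outflow_def)
      show "0 \<le> x k t"
      proof (rule linear_integral_equation_nonneg[OF x_continuous[OF k(1)] outflow_meas b_meas[OF k(1)] inflow _ _ _ t])
        show "0 \<le> x k 0" by (simp add: x_0[OF k(1)])
        show "x k t = x k 0 + integral {0..t} (\<lambda>u. outflow K b x (k + 1) u - b k u * x k u)"
          if "t \<in> {0..1}" for t
          using integral_unique[OF dynamics[OF k(1) that]] k by (simp add: outflow_def)
      qed (use b_bounds[OF k(1)] in auto)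
    qed
  qed
  with assms show ?thesis by blast
qed

lemma outflow_nonneg: "t \<in> {0..1} \<Longrightarrow> 0 \<le> outflow K b x k t"
  using b_bounds[of k t] x_nonneg[of k t] by (auto simp: outflow_def)

text \<open>
  The equations for \<open>k \<ge> j\<close> telescope: mass leaves the reservoirs \<open>j, \<dots>, K\<close> only through the outflow
  of \<open>j\<close>. Since this outflow is nonnegative, the tail sums are nonincreasing in time and
  bounded by their initial value 1.
\<close>

lemma tail_eq:
  assumes "j \<in> {1..K}" "t \<in> {0..1}"
  shows "(\<Sum>k = j..K. x k t) = 1 - integral {0..t} (outflow K b x j)"
proof -
  let ?Y = "\<lambda>k. integral {0..t} (outflow K b x k)"
  have "(\<Sum>k = j..K. x k t) = (\<Sum>k = j..K. (if k = K then 1 else 0) + (?Y (k + 1) - ?Y k))"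
    using assms by (intro sum.cong) (auto simp: x_eq[of _ t] x_0)
  also have "\<dots> = 1 + (\<Sum>k = j..K. ?Y (k + 1) - ?Y k)"
    using assms by (simp add: sum.distrib)
  also have "(\<Sum>k = j..K. ?Y (k + 1) - ?Y k) = ?Y (K + 1) - ?Y j"
    using assms sum_Suc_diff[of j K ?Y] by simp
  also have "outflow K b x (K + 1) = (\<lambda>_. 0)"
    by (auto simp: outflow_def)
  finally show ?thesis by simp
qed

lemma tail_antimono:
  assumes "j \<in> {1..K}" "0 \<le> t" "t \<le> u" "u \<le> 1"
  shows "(\<Sum>k = j..K. x k u) \<le> (\<Sum>k = j..K. x k t)"
proof -
  have "0 \<le> integral {t..u} (outflow K b x j)"
    using assms by (intro integral_nonneg bdd_meas_integrable outflow_meas outflow_nonneg) auto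
  then show ?thesis
    using assms bdd_meas_integral_split[OF outflow_meas, of 0 t u j] by (simp add: tail_eq)
qed

lemma x_le_1:
  assumes "k \<in> {1..K}" "t \<in> {0..1}"
  shows "x k t \<le> 1"
proof -
  have "x k t \<le> (\<Sum>k = k..K. x k t)"
    using assms by (intro member_le_sum x_nonneg) auto
  also have "\<dots> \<le> (\<Sum>k = k..K. x k 0)"
    using assms by (intro tail_antimono) auto
  also have "\<dots> = 1"
    using tail_eq[OF assms(1), of 0] by simp
  finally show ?thesis .
qed

lemma outflow_le:
  assumes "t \<in> {0..1}"
  shows "outflow K b x k t \<le> M"
proof (cases "k \<in> {1..K}")
  case True
  then have "b k t * x k t \<le> M * 1"
    using b_bounds[OF True assms] x_le_1[OF True assms] x_nonneg[OF True assms]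
    by (intro mult_mono) auto
  then show ?thesis using True by (simp add: outflow_def)
qed (use M_nonneg in \<open>auto simp: outflow_def\<close>)

lemma x_lipschitz:
  assumes "k \<in> {1..K}" "0 \<le> t" "t \<le> u" "u \<le> 1"
  shows "\<bar>x k u - x k t\<bar> \<le> M * (u - t)"
proof -
  let ?h = "\<lambda>u. outflow K b x (k + 1) u - outflow K b x k u"
  have h: "bdd_meas ?h" by (intro bdd_meas_diff outflow_meas)
  have eq: "x k v = x k 0 + integral {0..v} ?h" if "v \<in> {0..1}" for v
    using integral_unique[OF dynamics[OF assms(1) that]] by simp
  have "\<bar>integral {t..u} ?h\<bar> \<le> M * (u - t)"
  proof (rule bdd_meas_integral_abs_le[OF h])
    fix v assume "v \<in> {t..u}"
    then have "v \<in> {0..1}" using assms by auto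
    then show "\<bar>?h v\<bar> \<le> M"
      using outflow_nonneg[of v k] outflow_nonneg[of v "k + 1"]
        outflow_le[of v k] outflow_le[of v "k + 1"] by linarith
  qed (use assms in auto)
  then show ?thesis
    using bdd_meas_integral_split[OF h, of 0 t u] eq[of t] eq[of u] assms by simp
qed

end

text \<open>
  Continuity of the states in the rates, where the distance of the rates is measured in the weak sense of
  their integrals against the states of the first system. The cumulative outflows are compared rather
  than the states: their differences \<open>D k\<close> satisfy \<open>x k - x' k = D (k + 1) - D k\<close>, so the inequality for
  \<open>D k\<close> involves only \<open>D k\<close> itself, to which the Gronwall bound applies, and \<open>D (k + 1)\<close>, which is
  known by induction from the top.
\<close>

lemma cascade_stability:
  fixes \<delta> :: real
  assumes "cascade K M b x" "cascade K M b' x'" and "0 \<le> \<delta>"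
    and close: "\<And>k t. k \<in> {1..K} \<Longrightarrow> t \<in> {0..1} \<Longrightarrow>
      \<bar>integral {0..t} (\<lambda>u. (b k u - b' k u) * x k u)\<bar> \<le> \<delta>"
    and k: "k \<in> {1..K}" and t: "t \<in> {0..1}"
  shows "\<bar>x k t - x' k t\<bar> \<le> 2 * (2 * exp (2 * M) * (1 + M)) ^ K * \<delta>"
proof -
  interpret A: cascade K M b x by fact
  interpret B: cascade K M b' x' by fact
  define R where "R = 2 * exp (2 * M) * (1 + M)"
  have "1 * 1 \<le> exp (2 * M) * (1 + M)"
    using A.M_nonneg by (intro mult_mono) auto
  then have "1 \<le> R" by (simp add: R_def)
  define D where "D = (\<lambda>k t. integral {0..t} (\<lambda>u. outflow K b x k u - outflow K b' x' k u))"
  have out: "bdd_meas (\<lambda>u. outflow K b x k u - outflow K b' x' k u)" for k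
    by (intro bdd_meas_diff A.outflow_meas B.outflow_meas)
  have D_cont: "continuous_on {0..1} (D k)" for k
    unfolding D_def by (intro bdd_meas_indefinite_continuous out)
  have D_eq: "D k t = integral {0..t} (outflow K b x k) - integral {0..t} (outflow K b' x' k)"
    if "t \<in> {0..1}" for k t
    unfolding D_def using that
    by (intro integral_diff bdd_meas_integrable A.outflow_meas B.outflow_meas) auto
  have diff: "x k t - x' k t = D (k + 1) t - D k t" if "k \<in> {1..K}" "t \<in> {0..1}" for k t
    using A.x_eq[OF that] B.x_eq[OF that] A.x_0[OF that(1)] B.x_0[OF that(1)] D_eq[OF that(2)]
    by simp
  have D_bound: "\<forall>t\<in>{0..1}. \<bar>D (K + 1 - n) t\<bar> \<le> R ^ n * \<delta>" if "n \<le> K" for n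
    using that
  proof (induction n)
    case 0
    then show ?case
      using \<open>0 \<le> \<delta>\<close> by (simp add: D_def outflow_def)
  next
    case (Suc n)
    define j where "j = K - n"
    have j: "j \<in> {1..K}" "K + 1 - n = j + 1" "K + 1 - Suc n = j"
      using Suc.prems by (auto simp: j_def)
    have prev: "\<bar>D (j + 1) t\<bar> \<le> R ^ n * \<delta>" if "t \<in> {0..1}" for t
      using Suc j(2) that by simp
    define a where "a = \<delta> + M * (R ^ n * \<delta>)"
    have b'_abs: "\<And>u. u \<in> {0..1} \<Longrightarrow> \<bar>b' j u\<bar> \<le> M"
      using B.b_bounds[OF j(1)] by fastforce
    have "\<bar>D j t\<bar> \<le> a + \<bar>integral {0..t} (\<lambda>u. b' j u * D j u)\<bar>" if t: "t \<in> {0..1}" for t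
    proof -
      let ?f = "\<lambda>u. (b j u - b' j u) * x j u" and ?g = "\<lambda>u. b' j u * D (j + 1) u"
        and ?h = "\<lambda>u. b' j u * D j u"
      have meas: "bdd_meas ?f" "bdd_meas ?g" "bdd_meas ?h"
        by (intro bdd_meas_mult bdd_meas_diff A.b_meas B.b_meas A.x_meas j bdd_meas_continuous D_cont)+
      have "D j t = integral {0..t} (\<lambda>u. outflow K b x j u - outflow K b' x' j u)"
        by (simp add: D_def)
      also have "\<dots> = integral {0..t} (\<lambda>u. (?f u + ?g u) - ?h u)"
      proof (intro integral_cong)
        fix u assume "u \<in> {0..t}"
        then have "u \<in> {0..1}" using t by auto
        from diff[OF j(1) this] have x': "x' j u = x j u - (D (j + 1) u - D j u)" by simp
        show "outflow K b x j u - outflow K b' x' j u = (?f u + ?g u) - ?h u"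
          unfolding outflow_def x' using j(1) by (simp add: algebra_simps)
      qed
      also have "\<dots> = integral {0..t} ?f + integral {0..t} ?g - integral {0..t} ?h"
        using t meas by (simp add: integral_diff integral_add bdd_meas_integrable bdd_meas_add)
      finally have "\<bar>D j t\<bar> \<le> \<bar>integral {0..t} ?f\<bar> + \<bar>integral {0..t} ?g\<bar> + \<bar>integral {0..t} ?h\<bar>"
        by linarith
      moreover have "\<bar>integral {0..t} ?f\<bar> \<le> \<delta>"
        by (rule close[OF j(1) t])
      moreover have "\<bar>integral {0..t} ?g\<bar> \<le> M * (R ^ n * \<delta>) * (t - 0)"
      proof (rule bdd_meas_integral_abs_le[OF meas(2)])
        fix u assume "u \<in> {0..t}"
        then have "u \<in> {0..1}" using t by auto
        then show "\<bar>?g u\<bar> \<le> M * (R ^ n * \<delta>)"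
          unfolding abs_mult using prev b'_abs A.M_nonneg by (intro mult_mono) auto
      qed (use t in auto)
      moreover have "M * (R ^ n * \<delta>) * (t - 0) \<le> M * (R ^ n * \<delta>)"
        using t A.M_nonneg \<open>1 \<le> R\<close> \<open>0 \<le> \<delta>\<close> by (simp add: mult_left_le)
      ultimately show ?thesis by (simp add: a_def)
    qed
    moreover have "0 \<le> a"
      using A.M_nonneg \<open>1 \<le> R\<close> \<open>0 \<le> \<delta>\<close> by (simp add: a_def)
    ultimately have "\<bar>D j t\<bar> \<le> 2 * exp (2 * M) * a" if "t \<in> {0..1}" for t
      using gronwall_bound[OF D_cont B.b_meas[OF j(1)] _ A.M_nonneg b'_abs] that by blast
    moreover have "a \<le> (1 + M) * (R ^ n * \<delta>)"
    proof -
      have "1 * \<delta> \<le> R ^ n * \<delta>"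
        using \<open>1 \<le> R\<close> \<open>0 \<le> \<delta>\<close> by (intro mult_right_mono one_le_power)
      then show ?thesis by (simp add: a_def algebra_simps)
    qed
    then have "2 * exp (2 * M) * a \<le> R ^ Suc n * \<delta>"
      by (simp add: R_def mult_ac)
    ultimately show ?case unfolding j(3) by (meson order_trans)
  qed
  have D_le: "\<bar>D j t\<bar> \<le> R ^ K * \<delta>" if "j \<in> {1..K + 1}" for j
  proof -
    have "\<bar>D j t\<bar> \<le> R ^ (K + 1 - j) * \<delta>"
    proof -
      have "K + 1 - j \<le> K" "K + 1 - (K + 1 - j) = j" using that by auto
      then show ?thesis using D_bound[of "K + 1 - j"] t by simp
    qed
    also have "\<dots> \<le> R ^ K * \<delta>"
      using that \<open>1 \<le> R\<close> \<open>0 \<le> \<delta>\<close> by (intro mult_right_mono power_increasing) auto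
    finally show ?thesis .
  qed
  show ?thesis
    using D_le[of k] D_le[of "k + 1"] diff[OF k t] k unfolding R_def[symmetric] by auto
qed

section \<open>Chattering controls\<close>

text \<open>
  The earliest time in the cell \<open>[j/N, (j+1)/N]\<close> by which a control running at full rate \<open>lam\<close> has
  delivered the integral of \<open>f\<close> over this cell. Taking the earliest such time makes it monotone
  in \<open>f\<close>.
\<close>

definition burst_end :: "(real \<Rightarrow> real) \<Rightarrow> nat \<Rightarrow> (real \<Rightarrow> real) \<Rightarrow> nat \<Rightarrow> real" where
  "burst_end lam N f j = Inf {t \<in> {real j / real N..real (j + 1) / real N}.
     integral {real j / real N..real (j + 1) / real N} f \<le> integral {real j / real N..t} lam}"

definition bursts :: "(real \<Rightarrow> real) \<Rightarrow> nat \<Rightarrow> (real \<Rightarrow> real) \<Rightarrow> real set" where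
  "bursts lam N f = (\<Union>j<N. {real j / real N..<burst_end lam N f j})"

definition chatter :: "(real \<Rightarrow> real) \<Rightarrow> nat \<Rightarrow> (real \<Rightarrow> real) \<Rightarrow> real \<Rightarrow> real" where
  "chatter lam N f t = (if t \<in> bursts lam N f then lam t else 0)"

locale chattering =
  fixes lam :: "real \<Rightarrow> real" and N :: nat and M :: real
  assumes N_pos: "0 < N" and lam_meas: "bdd_meas lam"
    and lam_bounds: "t \<in> {0..1} \<Longrightarrow> 0 \<le> lam t \<and> lam t \<le> M"
begin

definition control :: "(real \<Rightarrow> real) \<Rightarrow> bool" where
  "control f \<longleftrightarrow> bdd_meas f \<and> (\<forall>t\<in>{0..1}. 0 \<le> f t \<and> f t \<le> lam t)"

lemma cell_in_unit_interval:
  assumes "j < N"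
  shows "0 \<le> real j / real N" "real j / real N \<le> real (j + 1) / real N" "real (j + 1) / real N \<le> 1"
  using assms N_pos by (auto simp: divide_simps)

lemma burst_end_spec:
  assumes f: "control f" and j: "j < N"
  shows "burst_end lam N f j \<in> {real j / real N..real (j + 1) / real N}"
    and "integral {real j / real N..burst_end lam N f j} lam
      = integral {real j / real N..real (j + 1) / real N} f"
proof -
  define a c where "a = real j / real N" and "c = real (j + 1) / real N"
  have ac: "0 \<le> a" "a \<le> c" "c \<le> 1"
    using cell_in_unit_interval[OF j] by (simp_all add: a_def c_def)
  define F where "F = (\<lambda>t. integral {a..t} lam)"
  define v where "v = integral {a..c} f"
  define T where "T = {t \<in> {a..c}. F t \<in> {v..}}"
  have F_cont: "continuous_on {a..c} F"
    unfolding F_def using ac by (intro indefinite_integral_continuous_1 bdd_meas_integrable lam_meas)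
  have F_mono: "F t \<le> F u" if "a \<le> t" "t \<le> u" "u \<le> c" for t u
  proof -
    have "F u = F t + integral {t..u} lam"
      unfolding F_def using that ac
      by (intro Henstock_Kurzweil_Integration.integral_combine[symmetric] bdd_meas_integrable lam_meas) auto
    moreover have "0 \<le> integral {t..u} lam"
      using that ac lam_bounds by (intro integral_nonneg bdd_meas_integrable lam_meas) auto
    ultimately show ?thesis by simp
  qed
  have "0 \<le> v" "v \<le> F c"
    unfolding v_def F_def using f ac lam_meas unfolding control_def
    by (auto intro!: integral_nonneg integral_le bdd_meas_integrable)
  then obtain p where p: "a \<le> p" "p \<le> c" "F p = v"
    using IVT'[of F a v c] F_cont ac by (auto simp: F_def)
  then have "p \<in> T" by (simp add: T_def)
  have "closed T"
    unfolding T_def using continuous_closed_preimage[OF F_cont, of "{v..}"]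
    by (simp add: vimage_def Int_def)
  moreover have bdd: "bdd_below T"
    unfolding T_def by (rule bdd_belowI[of _ a]) auto
  ultimately have inf: "Inf T \<in> T"
    using \<open>p \<in> T\<close> by (intro closed_contains_Inf) auto
  have eq: "burst_end lam N f j = Inf T"
    by (simp add: burst_end_def T_def F_def v_def a_def c_def)
  show "burst_end lam N f j \<in> {real j / real N..real (j + 1) / real N}"
    using inf unfolding eq by (simp add: T_def a_def c_def)
  have "Inf T \<le> p"
    using \<open>p \<in> T\<close> bdd by (rule cInf_lower)
  then have "F (Inf T) \<le> v"
    using F_mono[of "Inf T" p] inf p by (auto simp: T_def)
  then have "F (Inf T) = v" using inf by (simp add: T_def)
  then show "integral {real j / real N..burst_end lam N f j} lam
      = integral {real j / real N..real (j + 1) / real N} f"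
    unfolding eq by (simp add: F_def v_def a_def c_def)
qed

text \<open>
  This keeps the chattered controls ordered at every single time, and not merely almost everywhere.
\<close>

lemma bursts_mono:
  assumes f: "control f" and g: "control g" and le: "\<And>t. t \<in> {0..1} \<Longrightarrow> f t \<le> g t"
  shows "bursts lam N f \<subseteq> bursts lam N g"
proof -
  have "burst_end lam N f j \<le> burst_end lam N g j" if j: "j < N" for j
  proof -
    define a c where "a = real j / real N" and "c = real (j + 1) / real N"
    have ac: "0 \<le> a" "a \<le> c" "c \<le> 1"
      using cell_in_unit_interval[OF j] by (simp_all add: a_def c_def)
    have "integral {a..c} f \<le> integral {a..c} g"
      using f g le ac unfolding control_def by (intro integral_le bdd_meas_integrable) auto
    moreover have "burst_end lam N g j \<in> {a..c}"
      "integral {a..burst_end lam N g j} lam = integral {a..c} g"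
      using burst_end_spec[OF g j] by (simp_all add: a_def c_def)
    ultimately show ?thesis
      unfolding burst_end_def[of lam N f] a_def[symmetric] c_def[symmetric]
      by (intro cInf_lower bdd_belowI[of _ a]) auto
  qed
  then show ?thesis
    unfolding bursts_def by (fastforce intro: less_le_trans)
qed

lemma chatter_meas: "bdd_meas (chatter lam N f)"
proof -
  have "bursts lam N f \<in> sets lebesgue"
    unfolding bursts_def by (intro sets.finite_UN) auto
  from bdd_meas_if[OF lam_meas bdd_meas_const[of 0] this] show ?thesis
    by (simp add: chatter_def[abs_def])
qed

lemma chatter_bounds:
  "t \<in> {0..1} \<Longrightarrow> 0 \<le> chatter lam N f t \<and> chatter lam N f t \<le> lam t"
  using lam_bounds by (auto simp: chatter_def)

lemma chatter_mono:
  assumes "control f" "control g" "\<And>t. t \<in> {0..1} \<Longrightarrow> f t \<le> g t" "t \<in> {0..1}"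
  shows "chatter lam N f t \<le> chatter lam N g t"
  using bursts_mono[OF assms(1-3)] lam_bounds[OF assms(4)] by (auto simp: chatter_def)

lemma chatter_cell_integral:
  assumes f: "control f" and j: "j < N"
  shows "integral {real j / real N..real (j + 1) / real N} (chatter lam N f)
    = integral {real j / real N..real (j + 1) / real N} f"
proof -
  define a c where "a = real j / real N" and "c = real (j + 1) / real N"
  define \<tau> where "\<tau> = burst_end lam N f j"
  have \<tau>: "a \<le> \<tau>" "\<tau> \<le> c" "integral {a..\<tau>} lam = integral {a..c} f"
    using burst_end_spec[OF f j] by (simp_all add: a_def c_def \<tau>_def)
  \<comment> \<open>The right end \<open>c\<close> may lie in the burst of the next cell, and \<open>\<tau>\<close> itself is not in
    a burst; both points are negligible for the integral.\<close>
  have in_bursts: "t \<in> bursts lam N f \<longleftrightarrow> t \<in> {a..\<tau>}" if t: "t \<in> {a..c} - {\<tau>, c}" for t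
  proof
    assume "t \<in> bursts lam N f"
    then obtain i where i: "i < N" "real i / real N \<le> t" "t < burst_end lam N f i"
      by (auto simp: bursts_def)
    moreover have "burst_end lam N f i \<le> real (i + 1) / real N"
      using burst_end_spec(1)[OF f i(1)] by simp
    ultimately have "real i / real N < real (j + 1) / real N" "real j / real N < real (i + 1) / real N"
      using t by (auto simp: a_def c_def)
    then have "i = j"
      using N_pos by (simp add: divide_strict_right_mono divide_less_cancel)
    with i show "t \<in> {a..\<tau>}" by (simp add: a_def \<tau>_def)
  next
    assume "t \<in> {a..\<tau>}"
    with t show "t \<in> bursts lam N f"
      using j by (auto simp: bursts_def a_def \<tau>_def intro!: bexI[of _ j])
  qed
  have "integral {a..c} (chatter lam N f) = integral {a..c} (\<lambda>t. if t \<in> {a..\<tau>} then lam t else 0)"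
    by (rule integral_spike[of "{\<tau>, c}"]) (use in_bursts in \<open>auto simp: chatter_def\<close>)
  also have "\<dots> = integral ({a..\<tau>} \<inter> {a..c}) lam"
    by (rule integral_restrict_Int)
  also have "{a..\<tau>} \<inter> {a..c} = {a..\<tau>}"
    using \<tau> by auto
  finally show ?thesis
    using \<tau>(3) by (simp add: a_def c_def)
qed

text \<open>
  On a complete cell \<open>f\<close> and its chattered version have the same integral, so only the variation of the
  test function \<open>w\<close> over the cell contributes, at most \<open>M \<cdot> (L/N) \<cdot> (1/N)\<close>. The at most \<open>N\<close> complete
  cells before \<open>t\<close> contribute \<open>M L / N\<close>, and the incomplete cell at \<open>t\<close> adds \<open>M / N\<close>.
\<close>

lemma chatter_close:
  fixes L :: real
  assumes f: "control f" and w: "bdd_meas w"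
    and w1: "\<And>t. t \<in> {0..1} \<Longrightarrow> \<bar>w t\<bar> \<le> 1" and "0 \<le> L"
    and lip: "\<And>t u. 0 \<le> t \<Longrightarrow> t \<le> u \<Longrightarrow> u \<le> 1 \<Longrightarrow> \<bar>w u - w t\<bar> \<le> L * (u - t)"
    and t: "t \<in> {0..1}"
  shows "\<bar>integral {0..t} (\<lambda>u. (f u - chatter lam N f u) * w u)\<bar> \<le> M * (L + 1) / N"
proof -
  define h where "h = (\<lambda>u. f u - chatter lam N f u)"
  have f_meas: "bdd_meas f" using f by (simp add: control_def)
  have h_meas: "bdd_meas h"
    unfolding h_def by (intro bdd_meas_diff f_meas chatter_meas)
  have h_abs: "\<bar>h u\<bar> \<le> M" if "u \<in> {0..1}" for u
    using f that chatter_bounds[OF that, of f] lam_bounds[OF that]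
    by (force simp: h_def control_def abs_le_iff)
  have hw_meas: "bdd_meas (\<lambda>u. h u * w u)"
    by (intro bdd_meas_mult h_meas w)
  have "0 \<le> M" using lam_bounds[of 0] by auto
  have cell_bound: "\<bar>integral {real j / real N..real (j + 1) / real N} (\<lambda>u. h u * w u)\<bar> \<le> M * L / N\<^sup>2"
    if j: "j < N" for j
  proof -
    define a c where "a = real j / real N" and "c = real (j + 1) / real N"
    have ac: "0 \<le> a" "a \<le> c" "c \<le> 1" "c - a = 1 / real N"
      using cell_in_unit_interval[OF j] by (simp_all add: a_def c_def diff_divide_distrib[symmetric])
    have "integral {a..c} h = integral {a..c} f - integral {a..c} (chatter lam N f)"
      unfolding h_def using ac by (intro integral_diff bdd_meas_integrable f_meas chatter_meas) auto
    then have "integral {a..c} h = 0"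
      using chatter_cell_integral[OF f j] by (simp add: a_def c_def)
    moreover have "integral {a..c} (\<lambda>u. h u * (w u - w a))
        = integral {a..c} (\<lambda>u. h u * w u - h u * w a)"
      by (simp add: algebra_simps)
    moreover have "\<dots> = integral {a..c} (\<lambda>u. h u * w u) - integral {a..c} (\<lambda>u. h u * w a)"
      using ac by (intro integral_diff bdd_meas_integrable hw_meas bdd_meas_mult h_meas bdd_meas_const) auto
    ultimately have "integral {a..c} (\<lambda>u. h u * w u) = integral {a..c} (\<lambda>u. h u * (w u - w a))"
      by simp
    also have "\<bar>\<dots>\<bar> \<le> (M * (L * (1 / N))) * (c - a)"
    proof (rule bdd_meas_integral_abs_le)
      show "bdd_meas (\<lambda>u. h u * (w u - w a))"
        by (intro bdd_meas_mult bdd_meas_diff h_meas w bdd_meas_const)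
      fix u assume u: "u \<in> {a..c}"
      then have "\<bar>w u - w a\<bar> \<le> L * (u - a)" using ac by (intro lip) auto
      also have "\<dots> \<le> L * (1 / N)"
        using u ac \<open>0 \<le> L\<close> by (intro mult_left_mono) auto
      finally show "\<bar>h u * (w u - w a)\<bar> \<le> M * (L * (1 / N))"
        unfolding abs_mult using u ac \<open>0 \<le> M\<close> by (intro mult_mono h_abs) auto
    qed (use ac in auto)
    finally show ?thesis
      using ac(4) by (simp add: a_def c_def power2_eq_square)
  qed
  have grid_bound: "\<bar>integral {0..real n / real N} (\<lambda>u. h u * w u)\<bar> \<le> n * (M * L / N\<^sup>2)" if "n \<le> N" for n
    using that
  proof (induction n)
    case (Suc n)
    have "integral {0..real (n + 1) / real N} (\<lambda>u. h u * w u)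
        = integral {0..real n / real N} (\<lambda>u. h u * w u)
          + integral {real n / real N..real (n + 1) / real N} (\<lambda>u. h u * w u)"
      using cell_in_unit_interval[of n] Suc.prems by (intro bdd_meas_integral_split hw_meas) auto
    moreover have "real (Suc n) * (M * L / N\<^sup>2) = n * (M * L / N\<^sup>2) + M * L / N\<^sup>2"
      by (simp add: algebra_simps add_divide_distrib)
    ultimately show ?case
      using cell_bound[of n] Suc by simp
  qed simp
  define n where "n = nat \<lfloor>t * N\<rfloor>"
  have n: "real n \<le> t * N" "t * N \<le> real n + 1"
    using t by (auto simp: n_def intro: less_imp_le[OF real_of_int_floor_add_one_gt, THEN order_trans] 
        dest: of_nat_floor)
  have "t * N \<le> N" using t by (simp add: mult_left_le_one_le)
  with n have "n \<le> N" by linarith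
  have "integral {0..t} (\<lambda>u. h u * w u) = integral {0..real n / real N} (\<lambda>u. h u * w u)
      + integral {real n / real N..t} (\<lambda>u. h u * w u)"
    using n N_pos t by (intro bdd_meas_integral_split hw_meas) (auto simp: field_simps)
  moreover have "\<bar>integral {real n / real N..t} (\<lambda>u. h u * w u)\<bar> \<le> (M * 1) * (t - real n / real N)"
  proof (rule bdd_meas_integral_abs_le[OF hw_meas])
    fix u assume "u \<in> {real n / real N..t}"
    then have "u \<in> {0..1}"
      using t by (auto intro: order_trans[rotated])
    then show "\<bar>h u * w u\<bar> \<le> M * 1"
      unfolding abs_mult using \<open>0 \<le> M\<close> by (intro mult_mono h_abs w1) auto
  qed (use n N_pos t in \<open>auto simp: field_simps\<close>)
  moreover have "(M * 1) * (t - real n / real N) \<le> M * (1 / N)"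
  proof -
    have "t - real n / real N = (t * N - n) / N"
      using N_pos by (simp add: diff_divide_distrib)
    also have "\<dots> \<le> 1 / N"
      using n(2) by (intro divide_right_mono) auto
    finally show ?thesis
      unfolding mult_1_right using \<open>0 \<le> M\<close> by (intro mult_left_mono)
  qed
  moreover have "n * (M * L / N\<^sup>2) \<le> N * (M * L / N\<^sup>2)"
    using \<open>n \<le> N\<close> \<open>0 \<le> M\<close> \<open>0 \<le> L\<close> by (intro mult_right_mono) auto
  moreover have "N * (M * L / N\<^sup>2) + M * (1 / N) = M * (L + 1) / N"
    using N_pos by (simp add: power2_eq_square field_simps)
  ultimately show ?thesis
    using grid_bound[OF \<open>n \<le> N\<close>] unfolding h_def by linarith
qed

lemma chatter_integral:
  assumes f: "control f"
  shows "integral {0..1} (chatter lam N f) = integral {0..1} f"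
proof -
  have f_meas: "bdd_meas f" using f by (simp add: control_def)
  have "integral {0..real n / real N} (chatter lam N f) = integral {0..real n / real N} f" if "n \<le> N" for n
    using that
  proof (induction n)
    case (Suc n)
    have "integral {0..real (n + 1) / real N} g = integral {0..real n / real N} g
        + integral {real n / real N..real (n + 1) / real N} g" if "bdd_meas g" for g
      using cell_in_unit_interval[of n] Suc.prems that by (intro bdd_meas_integral_split) auto
    from this[OF f_meas] this[OF chatter_meas] show ?case
      using chatter_cell_integral[OF f, of n] Suc by simp
  qed simp
  from this[of N] show ?thesis using N_pos by simp
qed

end

section \<open>Late switching against a nonincreasing weight\<close>

text \<open>
  The switching time \<open>w\<close> that preserves the integral exists by the intermediate value theorem. The new
  control is at most \<open>a\<close> before \<open>w\<close>, where \<open>X \<ge> X w\<close>, and at least \<open>a\<close> after \<open>w\<close>, where \<open>X \<le> X w\<close>; hence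
  replacing \<open>X\<close> by the constant \<open>X w\<close> can only increase the integral of the change, and with a constant
  weight this integral is zero.
\<close>

lemma late_switch_optimal:
  assumes lo: "bdd_meas lo" and a: "bdd_meas a" and hi: "bdd_meas hi"
    and le: "\<And>t. t \<in> {0..1} \<Longrightarrow> lo t \<le> a t \<and> a t \<le> hi t"
  obtains w where "w \<in> {0..1}"
    "integral {0..1} (\<lambda>t. if t \<le> w then lo t else hi t) = integral {0..1} a"
    "\<And>X. bdd_meas X \<Longrightarrow> antimono_on {0..1} X \<Longrightarrow>
      integral {0..1} (\<lambda>t. (if t \<le> w then lo t else hi t) * X t) \<le> integral {0..1} (\<lambda>t. a t * X t)"
proof -
  define F where "F = (\<lambda>w. integral {0..1} hi - integral {0..w} (\<lambda>t. hi t - lo t))"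
  have cont: "continuous_on {0..1} F"
    unfolding F_def by (intro continuous_intros bdd_meas_indefinite_continuous bdd_meas_diff lo hi)
  have "F 1 = integral {0..1} lo"
    unfolding F_def using lo hi by (simp add: integral_diff bdd_meas_integrable)
  also have "\<dots> \<le> integral {0..1} a"
    using le by (intro integral_le bdd_meas_integrable lo a) auto
  finally have "F 1 \<le> integral {0..1} a" .
  moreover have "integral {0..1} a \<le> F 0"
    unfolding F_def using le by (auto intro!: integral_le bdd_meas_integrable hi a)
  ultimately obtain w where w: "w \<in> {0..1}" "F w = integral {0..1} a"
    using IVT2'[of F 1 "integral {0..1} a" 0] cont by auto
  define a' where "a' = (\<lambda>t. if t \<le> w then lo t else hi t)"
  have a': "bdd_meas a'"
    using bdd_meas_if[OF lo hi, of "{..w}"] by (simp add: a'_def)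
  have eq: "integral {0..1} a' = integral {0..1} a"
  proof -
    have "integral {0..1} (\<lambda>t. hi t - a' t) = integral {0..1} (\<lambda>t. if t \<in> {0..w} then hi t - lo t else 0)"
      by (intro integral_cong) (auto simp: a'_def)
    also have "\<dots> = integral ({0..w} \<inter> {0..1}) (\<lambda>t. hi t - lo t)"
      by (rule integral_restrict_Int)
    also have "{0..w} \<inter> {0..1} = {0..w}" using w by auto
    finally have "integral {0..1} hi - integral {0..1} a' = integral {0..w} (\<lambda>t. hi t - lo t)"
      using hi a' by (simp add: integral_diff bdd_meas_integrable)
    with w(2) show ?thesis by (simp add: F_def)
  qed
  have "integral {0..1} (\<lambda>t. a' t * X t) \<le> integral {0..1} (\<lambda>t. a t * X t)"
    if X: "bdd_meas X" and "antimono_on {0..1} X" for X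
  proof -
    have anti: "X u \<le> X t" if "t \<in> {0..1}" "u \<in> {0..1}" "t \<le> u" for t u
      using \<open>antimono_on {0..1} X\<close> that by (rule monotone_onD)
    have "(a' t - a t) * (X t - X w) \<le> 0" if t: "t \<in> {0..1}" for t
    proof (cases "t \<le> w")
      case True
      then show ?thesis
        using le[OF t] anti[of t w] t w by (intro mult_nonpos_nonneg) (auto simp: a'_def)
    next
      case False
      then show ?thesis
        using le[OF t] anti[of w t] t w by (intro mult_nonneg_nonpos) (auto simp: a'_def)
    qed
    then have pt: "a' t * X t - a t * X t \<le> a' t * X w - a t * X w" if "t \<in> {0..1}" for t
      using that by (simp add: algebra_simps)
    have "integral {0..1} (\<lambda>t. a' t * X t - a t * X t) \<le> integral {0..1} (\<lambda>t. a' t * X w - a t * X w)"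
      using pt by (intro integral_le bdd_meas_integrable bdd_meas_diff bdd_meas_mult a a' X) auto
    also have "\<dots> = integral {0..1} (\<lambda>t. a' t * X w) - integral {0..1} (\<lambda>t. a t * X w)"
      by (intro integral_diff bdd_meas_integrable bdd_meas_mult a a') auto
    also have "\<dots> = 0"
      using eq by simp
    finally show ?thesis
      using a a' X by (simp add: integral_diff bdd_meas_integrable bdd_meas_mult)
  qed
  with w(1) eq show thesis
    unfolding a'_def by (rule that)
qed

section \<open>Switching vectors\<close>

lemma switching_vector_Suc:
  assumes "switching_vector K m s" "i \<in> {1..m}"
  shows "s (i + 1) < s i"
  using assms unfolding switching_vector_def by blast

lemma switching_vector_antimono:
  assumes s: "switching_vector K m s" and "1 \<le> i" "i \<le> j" "j \<le> m + 1"
  shows "s j \<le> s i"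
  using assms(3,4)
proof (induction rule: dec_induct)
  case (step n)
  have "s (n + 1) < s n"
    using step.hyps step.prems \<open>1 \<le> i\<close> by (intro switching_vector_Suc[OF s]) simp
  moreover have "s n \<le> s i"
    using step.IH step.prems by linarith
  ultimately show ?case by simp
qed simp

lemma switching_vector_less:
  assumes "switching_vector K m s" "i < m"
  shows "s (i + 1 + 1) < K" and "s (i + 1) \<le> K"
proof -
  have "s (i + 1 + 1) < s (i + 1)"
    using assms(2) by (intro switching_vector_Suc[OF assms(1)]) simp
  moreover have "s (i + 1) \<le> s 1"
    using assms(2) by (intro switching_vector_antimono[OF assms(1)]) simp_all
  moreover have "s 1 = K"
    using assms(1) by (simp add: switching_vector_def)
  ultimately show "s (i + 1 + 1) < K" "s (i + 1) \<le> K"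
    by linarith+
qed

lemma switch_index_spec:
  assumes s: "switching_vector K m s" and k: "k \<in> {1..K}"
  shows "switch_index m s k \<in> {1..m} \<and> s (switch_index m s k + 1) < k \<and> k \<le> s (switch_index m s k)"
  unfolding switch_index_def
proof (rule theI')
  define j where "j = (LEAST j. s (j + 1) < k)"
  have m: "s (m + 1) < k" "s 1 = K"
    using s k by (simp_all add: switching_vector_def)
  have j: "s (j + 1) < k" "j \<le> m"
    unfolding j_def
    using m(1) LeastI[of "\<lambda>j. s (j + 1) < k" m] Least_le[of "\<lambda>j. s (j + 1) < k" m] by blast+
  have minimal: "k \<le> s (i + 1)" if "i < j" for i
    using not_less_Least[of i "\<lambda>j. s (j + 1) < k"] that unfolding j_def by simp
  have "j \<noteq> 0"
    using j(1) m(2) k by (cases "j = 0") simp_all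
  with minimal[of "j - 1"] j have ex: "j \<in> {1..m}" "s (j + 1) < k" "k \<le> s j"
    by simp_all
  show "\<exists>!i. i \<in> {1..m} \<and> s (i + 1) < k \<and> k \<le> s i"
  proof (rule ex1I[of _ j])
    show "j \<in> {1..m} \<and> s (j + 1) < k \<and> k \<le> s j"
      using ex by blast
  next
    fix i assume i: "i \<in> {1..m} \<and> s (i + 1) < k \<and> k \<le> s i"
    show "i = j"
    proof (rule ccontr)
      assume "i \<noteq> j"
      then consider "i < j" | "j < i" by linarith
      then show False
      proof cases
        case 1
        then have "s j \<le> s (i + 1)"
          using i ex by (intro switching_vector_antimono[OF s]) simp_all
        with i ex show False by linarith
      next
        case 2
        then have "s i \<le> s (j + 1)"
          using i ex by (intro switching_vector_antimono[OF s]) simp_all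
        with i ex show False by linarith
      qed
    qed
  qed
qed

text \<open>
  Every rate in the first sum of the constraint with number \<open>i\<close> is therefore some \<open>\<beta>\<^sup>j\<close> with
  \<open>j \<ge> i + 1\<close>, which is dominated by \<open>\<alpha>\<^sup>i\<close>.
\<close>

lemma switch_index_ge:
  assumes s: "switching_vector K m s" and "i < m" "k \<in> {1..s (i + 1)}"
  shows "i + 1 \<le> switch_index m s k" "switch_index m s k \<le> m"
proof -
  have "k \<in> {1..K}"
    using assms switching_vector_less(2)[OF s, of i] by auto
  note idx = switch_index_spec[OF s this]
  then show "switch_index m s k \<le> m" by simp
  show "i + 1 \<le> switch_index m s k"
  proof (rule ccontr)
    assume "\<not> i + 1 \<le> switch_index m s k"
    then have "s (i + 1) \<le> s (switch_index m s k + 1)"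
      using assms by (intro switching_vector_antimono[OF s]) auto
    with idx assms(3) show False by simp
  qed
qed

section \<open>Positivity of the Poisson terms\<close>

lemma Pois_prob_pos:
  assumes "0 \<le> A"
  shows "0 < measure_pmf.prob (Pois A) {..n}"
proof -
  have "0 \<in> set_pmf (Pois A)"
    using assms by (cases "A = 0") (simp_all add: Pois_def set_pmf_iff)
  then show ?thesis
    by (rule measure_pmf_posI) simp
qed

lemma Pois_expectation_min_pos:
  assumes "0 < A" "1 \<le> K"
  shows "0 < measure_pmf.expectation (Pois A) (\<lambda>n. real (min n K))"
proof -
  have "0 < pmf (Pois A) 1"
    using assms by (simp add: Pois_def)
  also have "pmf (Pois A) 1 = measure_pmf.expectation (Pois A) (indicator {1})"
    by (simp add: measure_pmf_single)
  also have "\<dots> \<le> measure_pmf.expectation (Pois A) (\<lambda>n. real (min n K))"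
  proof (rule integral_mono)
    show "integrable (measure_pmf (Pois A)) (indicator {1} :: nat \<Rightarrow> real)"
      by (rule measure_pmf.integrable_const_bound[where B=1]) auto
    show "integrable (measure_pmf (Pois A)) (\<lambda>n. real (min n K))"
      by (rule measure_pmf.integrable_const_bound[where B="real K"]) auto
    show "indicator {1} n \<le> real (min n K)" for n
      using assms(2) by (simp add: indicator_def)
  qed
  finally show ?thesis .
qed

section \<open>Feasibility in terms of the flow\<close>

text \<open>
  The constraints on the controls alone, rearranged so that the indices at the two ends of the chain
  need no special treatment.
\<close>

definition admissible ::
  "nat \<Rightarrow> real \<Rightarrow> (real \<Rightarrow> real) \<Rightarrow> (nat \<Rightarrow> real \<Rightarrow> real) \<Rightarrow> (nat \<Rightarrow> real \<Rightarrow> real) \<Rightarrow> bool" where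
  "admissible m M lam \<alpha> \<beta> \<longleftrightarrow>
     bdd_meas lam \<and> (\<forall>i\<in>{0..m}. bdd_meas (\<alpha> i)) \<and> (\<forall>i\<in>{1..m}. bdd_meas (\<beta> i)) \<and>
     (\<forall>t\<in>{0..1}.
        \<alpha> m t = 0 \<and> \<alpha> 0 t = lam t \<and> lam t \<le> M \<and>
        (\<forall>i\<in>{0..m - 1}. \<beta> (i + 1) t \<le> \<alpha> i t) \<and>
        (\<forall>i\<in>{1..m}. \<alpha> i t \<le> \<beta> i t \<and> 0 \<le> \<beta> i t \<and> \<beta> i t \<le> lam t))"

definition load ::
  "nat \<Rightarrow> nat \<Rightarrow> (nat \<Rightarrow> nat) \<Rightarrow> (nat \<Rightarrow> real \<Rightarrow> real) \<Rightarrow> (nat \<Rightarrow> real \<Rightarrow> real) \<Rightarrow>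
   (nat \<Rightarrow> real \<Rightarrow> real) \<Rightarrow> nat \<Rightarrow> real" where
  "load K m s \<alpha> \<beta> x i =
     (\<Sum>k = 1..s (i + 1). integral {0..1} (\<lambda>t. \<beta> (switch_index m s k) t * x k t))
     + (\<Sum>k = s (i + 1) + 1..K. integral {0..1} (\<lambda>t. \<alpha> i t * x k t))"

lemma admissible_alpha_bounds:
  assumes ad: "admissible m M lam \<alpha> \<beta>" and i: "i \<le> m" and t: "t \<in> {0..1}" and "1 \<le> m"
  shows "0 \<le> \<alpha> i t" "\<alpha> i t \<le> lam t"
proof -
  have "0 \<le> \<alpha> i t \<and> \<alpha> i t \<le> lam t"
  proof (cases "i = m")
    case True
    then have "\<alpha> i t = 0" "0 \<le> \<beta> 1 t" "\<beta> 1 t \<le> lam t"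
      using ad t \<open>1 \<le> m\<close> by (auto simp: admissible_def)
    then show ?thesis by linarith
  next
    case False
    then have "0 \<le> \<beta> (i + 1) t" "\<beta> (i + 1) t \<le> \<alpha> i t"
      using ad i t by (auto simp: admissible_def)
    moreover have "\<alpha> i t \<le> lam t"
    proof (cases "i = 0")
      case False
      with ad i t have "\<alpha> i t \<le> \<beta> i t" "\<beta> i t \<le> lam t"
        by (auto simp: admissible_def)
      then show ?thesis by linarith
    qed (use ad t in \<open>auto simp: admissible_def\<close>)
    ultimately show ?thesis by linarith
  qed
  then show "0 \<le> \<alpha> i t" "\<alpha> i t \<le> lam t" by auto
qed

lemma admissible_beta_antimono:
  assumes ad: "admissible m M lam \<alpha> \<beta>" and "1 \<le> i" "i \<le> j" "j \<le> m" and t: "t \<in> {0..1}"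
  shows "\<beta> j t \<le> \<beta> i t"
  using assms(3,4)
proof (induction rule: dec_induct)
  case (step n)
  then have "\<beta> (n + 1) t \<le> \<alpha> n t" "\<alpha> n t \<le> \<beta> n t"
    using ad t \<open>1 \<le> i\<close> by (auto simp: admissible_def)
  with step show ?case by simp
qed simp

lemma admissible_rates:
  assumes ad: "admissible m M lam \<alpha> \<beta>" and s: "switching_vector K m s" and "1 \<le> K" "0 \<le> M"
  shows "rates K M (\<lambda>k. \<beta> (switch_index m s k))"
proof
  fix k assume "k \<in> {1..K}"
  then have idx: "switch_index m s k \<in> {1..m}"
    using switch_index_spec[OF s] by blast
  then show "bdd_meas (\<beta> (switch_index m s k))"
    using ad by (auto simp: admissible_def)
  fix t :: real assume "t \<in> {0..1}"
  with ad idx show "0 \<le> \<beta> (switch_index m s k) t \<and> \<beta> (switch_index m s k) t \<le> M"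
    unfolding admissible_def by (meson order_trans)
qed (use assms in auto)

lemma feasible_iff_cascade:
  assumes "1 \<le> m" and "1 \<le> K" "0 \<le> M" and s: "switching_vector K m s"
  shows "feasible K m s M \<theta> lam \<alpha> \<beta> \<longleftrightarrow>
    admissible m M lam \<alpha> \<beta> \<and>
    (\<exists>x. cascade K M (\<lambda>k. \<beta> (switch_index m s k)) x \<and>
       (\<forall>i\<in>{1..m}. (\<Sum>k = s (i + 1) + 1..K. x k 1)
          \<le> \<theta> * measure_pmf.prob (Pois (integral {0..1} (\<alpha> i))) {..K - 1}) \<and>
       (\<forall>i\<in>{0..m - 1}. load K m s \<alpha> \<beta> x i
          \<le> \<theta> * measure_pmf.expectation (Pois (integral {0..1} (\<alpha> i))) (\<lambda>n. real (min n K))))"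
proof -
  define meas where "meas \<longleftrightarrow> lam \<in> borel_measurable (lebesgue_on {0..1}) \<and>
     (\<forall>i\<in>{0..m}. \<alpha> i \<in> borel_measurable (lebesgue_on {0..1})) \<and>
     (\<forall>i\<in>{1..m}. \<beta> i \<in> borel_measurable (lebesgue_on {0..1}))"
  define bounds where "bounds \<longleftrightarrow> (\<forall>t\<in>{0..1}.
        \<alpha> m t = 0 \<and> \<alpha> 0 t = lam t \<and>
        0 \<le> \<beta> 1 t \<and> \<beta> 1 t \<le> lam t \<and> lam t \<le> M \<and>
        (\<forall>i\<in>{1..m - 1}.
           0 \<le> \<beta> (i + 1) t \<and> \<beta> (i + 1) t \<le> \<alpha> i t \<and> \<alpha> i t \<le> \<beta> i t \<and> \<beta> i t \<le> lam t))"
  define bounds' where "bounds' \<longleftrightarrow> (\<forall>t\<in>{0..1}.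
        \<alpha> m t = 0 \<and> \<alpha> 0 t = lam t \<and> lam t \<le> M \<and>
        (\<forall>i\<in>{0..m - 1}. \<beta> (i + 1) t \<le> \<alpha> i t) \<and>
        (\<forall>i\<in>{1..m}. \<alpha> i t \<le> \<beta> i t \<and> 0 \<le> \<beta> i t \<and> \<beta> i t \<le> lam t))"
  have bounds: "bounds \<longleftrightarrow> bounds'"
  proof
    assume b: bounds
    show bounds'
      unfolding bounds'_def
    proof (intro ballI conjI)
      fix t i assume t: "t \<in> {0..1::real}" and "i \<in> {0..m - 1}"
      then show "\<beta> (i + 1) t \<le> \<alpha> i t"
        using b unfolding bounds_def by (cases "i = 0") auto
    next
      fix t i assume t: "t \<in> {0..1::real}" and i: "i \<in> {1..m}"
      show nn: "0 \<le> \<beta> i t"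
      proof (cases "i = 1")
        case False
        with i have "i - 1 \<in> {1..m - 1}" "i - 1 + 1 = i" by auto
        with b t show ?thesis unfolding bounds_def by metis
      qed (use b t in \<open>auto simp: bounds_def\<close>)
      show "\<alpha> i t \<le> \<beta> i t"
        using b t i nn unfolding bounds_def by (cases "i = m") auto
      show "\<beta> i t \<le> lam t"
      proof (cases "i = 1")
        case False
        with i have "i - 1 \<in> {1..m - 1}" "i - 1 + 1 = i" by auto
        with b t show ?thesis unfolding bounds_def by (metis order_trans)
      qed (use b t in \<open>auto simp: bounds_def\<close>)
    qed (use b in \<open>auto simp: bounds_def\<close>)
  next
    assume b: bounds'
    have "\<beta> 1 t \<le> lam t" "0 \<le> \<beta> 1 t" if "t \<in> {0..1}" for t
      using b that \<open>1 \<le> m\<close> by (auto simp: bounds'_def)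
    with b show bounds
      by (auto simp: bounds_def bounds'_def)
  qed
  have admissible: "meas \<and> bounds \<longleftrightarrow> admissible m M lam \<alpha> \<beta>"
  proof
    assume mb: "meas \<and> bounds"
    have "bdd_meas f"
      if "f \<in> borel_measurable (lebesgue_on {0..1})" "\<And>t. t \<in> {0..1} \<Longrightarrow> 0 \<le> f t \<and> f t \<le> M" for f
      using that by (intro bdd_measI[where B=M]) auto
    note bm = this
    have b': "\<And>t. t \<in> {0..1} \<Longrightarrow> lam t \<le> M"
      "\<And>t i. t \<in> {0..1} \<Longrightarrow> i \<in> {1..m} \<Longrightarrow> \<alpha> i t \<le> \<beta> i t \<and> 0 \<le> \<beta> i t \<and> \<beta> i t \<le> lam t"
      "\<And>t i. t \<in> {0..1} \<Longrightarrow> i \<in> {0..m - 1} \<Longrightarrow> \<beta> (i + 1) t \<le> \<alpha> i t"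
      "\<And>t. t \<in> {0..1} \<Longrightarrow> \<alpha> m t = 0 \<and> \<alpha> 0 t = lam t"
      using mb unfolding bounds bounds'_def by auto
    have "bdd_meas lam"
    proof (rule bm)
      fix t :: real assume t: "t \<in> {0..1}"
      show "0 \<le> lam t \<and> lam t \<le> M"
        using b'(1)[OF t] b'(2)[OF t, of 1] \<open>1 \<le> m\<close> by auto
    qed (use mb meas_def in auto)
    moreover have "bdd_meas (\<beta> i)" if i: "i \<in> {1..m}" for i
    proof (rule bm)
      fix t :: real assume t: "t \<in> {0..1}"
      show "0 \<le> \<beta> i t \<and> \<beta> i t \<le> M"
        using b'(1)[OF t] b'(2)[OF t i] by auto
    qed (use mb meas_def i in auto)
    moreover have "bdd_meas (\<alpha> i)" if i: "i \<in> {0..m}" for i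
    proof (rule bm)
      fix t :: real assume t: "t \<in> {0..1}"
      show "0 \<le> \<alpha> i t \<and> \<alpha> i t \<le> M"
      proof (cases "i = m")
        case False
        with i have i1: "i + 1 \<in> {1..m}" "i \<in> {0..m - 1}" by auto
        have "0 \<le> \<alpha> i t"
          using b'(2)[OF t i1(1)] b'(3)[OF t i1(2)] by linarith
        moreover have "\<alpha> i t \<le> M"
        proof (cases "i = 0")
          case False
          with i show ?thesis using b'(1)[OF t] b'(2)[OF t, of i] by force
        qed (use b'(1,4)[OF t] in auto)
        ultimately show ?thesis by simp
      qed (use b'(4)[OF t] \<open>0 \<le> M\<close> in auto)
    qed (use mb meas_def i in auto)
    ultimately show "admissible m M lam \<alpha> \<beta>"
      using mb unfolding admissible_def bounds bounds'_def by blast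
  next
    assume "admissible m M lam \<alpha> \<beta>"
    then show "meas \<and> bounds"
      unfolding admissible_def meas_def bounds bounds'_def bdd_meas_def by blast
  qed
  have state: "state_solution K m s \<beta> x \<longleftrightarrow> cascade K M (\<lambda>k. \<beta> (switch_index m s k)) x"
    if ad: "admissible m M lam \<alpha> \<beta>" for x
  proof -
    have "flow_rate K m s \<beta> x = outflow K (\<lambda>k. \<beta> (switch_index m s k)) x"
      by (intro ext) (simp add: flow_rate_def outflow_def)
    then show ?thesis
      using admissible_rates[OF ad s assms(2,3)]
      unfolding state_solution_def cascade_def cascade_axioms_def by auto
  qed
  have "feasible K m s M \<theta> lam \<alpha> \<beta> \<longleftrightarrow> (meas \<and> bounds) \<and>
     (\<exists>x. state_solution K m s \<beta> x \<and>
        (\<forall>i\<in>{1..m}. (\<Sum>k = s (i + 1) + 1..K. x k 1)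
          \<le> \<theta> * measure_pmf.prob (Pois (integral {0..1} (\<alpha> i))) {..K - 1}) \<and>
        (\<forall>i\<in>{0..m - 1}. load K m s \<alpha> \<beta> x i
          \<le> \<theta> * measure_pmf.expectation (Pois (integral {0..1} (\<alpha> i))) (\<lambda>n. real (min n K))))"
    unfolding feasible_def meas_def bounds_def load_def by blast
  then show ?thesis
    unfolding admissible using state by blast
qed

section \<open>Extremal controls\<close>

lemma threshold_of_antimono:
  fixes P :: "nat \<Rightarrow> bool"
  assumes "\<And>i j. 1 \<le> i \<Longrightarrow> i \<le> j \<Longrightarrow> j \<le> m \<Longrightarrow> P j \<Longrightarrow> P i"
  obtains r where "r \<in> {1..m + 1}" "\<And>i. i \<in> {1..m} \<Longrightarrow> P i \<longleftrightarrow> i < r"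
proof -
  let ?Q = "\<lambda>r. 1 \<le> r \<and> (r \<le> m \<longrightarrow> \<not> P r)"
  define r where "r = (LEAST r. ?Q r)"
  have top: "?Q (m + 1)" by simp
  have r: "?Q r" "r \<le> m + 1"
    unfolding r_def using LeastI[of ?Q, OF top] Least_le[of ?Q, OF top] by blast+
  have "P i \<longleftrightarrow> i < r" if "i \<in> {1..m}" for i
  proof
    assume "P i"
    show "i < r"
    proof (rule ccontr)
      assume "\<not> i < r"
      then have "P r" using assms[of r i] r \<open>P i\<close> that by simp
      then show False using r \<open>\<not> i < r\<close> that by simp
    qed
  next
    assume "i < r"
    then show "P i" using not_less_Least[of i ?Q] that unfolding r_def by auto
  qed
  with r show thesis by (intro that[of r]) auto
qed

text \<open>
  The chattered controls of the overview, with \<open>N\<close> so large that the \<open>O(1/N)\<close> error in each constraint is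
  below \<open>\<epsilon>\<close> times the positive Poisson factor of that constraint.
\<close>

lemma feasible_bang_bang:
  assumes m: "1 \<le> m" and K: "1 \<le> K" and M: "0 \<le> M" and s: "switching_vector K m s"
    and feas: "feasible K m s M \<theta> lam \<alpha> \<beta>" and "0 < \<epsilon>"
  obtains \<alpha>' \<beta>' where "feasible K m s M (\<theta> + \<epsilon>) lam \<alpha>' \<beta>'"
    "\<forall>t\<in>{0..1}. \<exists>r\<in>{1..m + 1}. \<forall>i\<in>{1..m}.
       (r \<le> i \<longrightarrow> \<beta>' i t = 0) \<and> (i < r \<longrightarrow> \<beta>' i t = lam t)"
proof -
  note iff = feasible_iff_cascade[OF m K M s]
  define P where "P = (\<lambda>i. measure_pmf.prob (Pois (integral {0..1} (\<alpha> i))) {..K - 1})"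
  define E where "E = (\<lambda>i. measure_pmf.expectation (Pois (integral {0..1} (\<alpha> i))) (\<lambda>n. real (min n K)))"
  obtain x where ad: "admissible m M lam \<alpha> \<beta>"
    and cas: "cascade K M (\<lambda>k. \<beta> (switch_index m s k)) x"
    and tails: "\<And>i. i \<in> {1..m} \<Longrightarrow> (\<Sum>k = s (i + 1) + 1..K. x k 1) \<le> \<theta> * P i"
    and loads: "\<And>i. i \<in> {0..m - 1} \<Longrightarrow> load K m s \<alpha> \<beta> x i \<le> \<theta> * E i"
    using feas unfolding iff P_def E_def by blast
  interpret A: cascade K M "\<lambda>k. \<beta> (switch_index m s k)" x by fact
  have \<alpha>_meas: "bdd_meas (\<alpha> i)" if "i \<le> m" for i
    using ad that by (simp add: admissible_def)
  have \<alpha>_integral_nonneg: "0 \<le> integral {0..1} (\<alpha> i)" if "i \<le> m" for i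
    using that by (intro integral_nonneg bdd_meas_integrable \<alpha>_meas admissible_alpha_bounds[OF ad _ _ m]) auto
  have P_pos: "0 < P i" if "i \<in> {1..m}" for i
    unfolding P_def using that by (intro Pois_prob_pos \<alpha>_integral_nonneg) simp
  have E_pos: "0 < E i" if "integral {0..1} (\<alpha> i) \<noteq> 0" "i \<in> {0..m - 1}" for i
  proof -
    have "i \<le> m" using that(2) by auto
    then have "0 < integral {0..1} (\<alpha> i)"
      using \<alpha>_integral_nonneg[of i] that(1) by simp
    then show ?thesis
      unfolding E_def using K by (rule Pois_expectation_min_pos)
  qed

  \<comment> \<open>The states have Lipschitz constant \<open>M\<close>, so by \<open>chatter_close\<close> the integrals of the rates against
    the states are perturbed by at most \<open>\<delta> = M (M + 1) / N\<close>. The states then move by at most \<open>R \<delta>\<close>, each of the \<open>K\<close> terms of a right-hand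
    side by at most \<open>\<delta> + (M + 1) R \<delta>\<close>, and the sum of these errors is at most \<open>G / N\<close>.\<close>
  define R where "R = 2 * (2 * exp (2 * M) * (1 + M)) ^ K"
  define G where "G = real K * (M * (M + 1)) * (1 + (M + 1) * R)"
  have "0 \<le> R" using M by (simp add: R_def)
  have lim: "(\<lambda>N. G / real N) \<longlonglongrightarrow> 0"
    by (rule lim_const_over_n)
  have small: "\<forall>\<^sub>F N in sequentially. G / real N < \<epsilon> * c" if "0 < c" for c
    using order_tendstoD(2)[OF lim, of "\<epsilon> * c"] that \<open>0 < \<epsilon>\<close> by simp
  have "\<forall>\<^sub>F N in sequentially. 0 < N \<and> (\<forall>i\<in>{1..m}. G / real N < \<epsilon> * P i) \<and>
      (\<forall>i\<in>{i \<in> {0..m - 1}. integral {0..1} (\<alpha> i) \<noteq> 0}. G / real N < \<epsilon> * E i)"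
    by (intro eventually_conj eventually_gt_at_top eventually_ball_finite ballI small) (auto intro: P_pos E_pos)
  then obtain N where N: "0 < N" "\<And>i. i \<in> {1..m} \<Longrightarrow> G / real N < \<epsilon> * P i"
    "\<And>i. i \<in> {0..m - 1} \<Longrightarrow> integral {0..1} (\<alpha> i) \<noteq> 0 \<Longrightarrow> G / real N < \<epsilon> * E i"
    by (auto simp: eventually_sequentially)

  interpret C: chattering lam N M
  proof
    show "bdd_meas lam" using ad by (simp add: admissible_def)
    fix t :: real assume "t \<in> {0..1}"
    then show "0 \<le> lam t \<and> lam t \<le> M"
      using ad admissible_alpha_bounds[OF ad, of 0 t] m by (auto simp: admissible_def)
  qed fact
  have ctrl_\<alpha>: "C.control (\<alpha> i)" if "i \<le> m" for i
    unfolding C.control_def using \<alpha>_meas[OF that] admissible_alpha_bounds[OF ad that _ m] by blast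
  have ctrl_\<beta>: "C.control (\<beta> i)" if "i \<in> {1..m}" for i
    unfolding C.control_def using ad that by (simp add: admissible_def)
  define \<beta>' where "\<beta>' = (\<lambda>i. chatter lam N (\<beta> i))"
  \<comment> \<open>The two ends of the chain are set directly: for \<open>i = 0\<close> the chattered version of \<open>lam\<close> could differ
    from \<open>lam\<close> on a null set, and the constraint \<open>\<alpha>\<^sup>0 = lam\<close> is required at every time.\<close>
  define \<alpha>' where "\<alpha>' = (\<lambda>i. if i = 0 then lam else if i = m then (\<lambda>_. 0) else chatter lam N (\<alpha> i))"
  have \<alpha>0: "\<alpha> 0 t = lam t" and \<alpha>m: "\<alpha> m t = 0" if "t \<in> {0..1}" for t
    using ad that by (auto simp: admissible_def)
  have \<alpha>'_meas: "bdd_meas (\<alpha>' i)" for i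
    using C.lam_meas C.chatter_meas by (auto simp: \<alpha>'_def)
  have \<alpha>'_bounds: "0 \<le> \<alpha>' i t \<and> \<alpha>' i t \<le> lam t" if "t \<in> {0..1}" for i t
    using C.chatter_bounds[OF that] C.lam_bounds[OF that] by (auto simp: \<alpha>'_def)
  have ad': "admissible m M lam \<alpha>' \<beta>'"
    unfolding admissible_def
  proof (intro conjI ballI)
    fix t :: real assume t: "t \<in> {0..1}"
    show "\<alpha>' m t = 0" "\<alpha>' 0 t = lam t" using m by (simp_all add: \<alpha>'_def)
    show "lam t \<le> M" using C.lam_bounds[OF t] by simp
    fix i
    show "\<beta>' (i + 1) t \<le> \<alpha>' i t" if i: "i \<in> {0..m - 1}"
    proof (cases "i = 0")
      case True
      then show ?thesis using C.chatter_bounds[OF t] by (simp add: \<alpha>'_def \<beta>'_def)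
    next
      case False
      with i have "i \<noteq> m" "i + 1 \<in> {1..m}" "i \<le> m" by auto
      then have "chatter lam N (\<beta> (i + 1)) t \<le> chatter lam N (\<alpha> i) t"
        using ad i by (intro C.chatter_mono ctrl_\<alpha> ctrl_\<beta> t) (auto simp: admissible_def)
      then show ?thesis using False \<open>i \<noteq> m\<close> by (simp add: \<alpha>'_def \<beta>'_def)
    qed
    assume i: "i \<in> {1..m}"
    show "\<alpha>' i t \<le> \<beta>' i t"
    proof (cases "i = m")
      case True
      then show ?thesis using m C.chatter_bounds[OF t] by (simp add: \<alpha>'_def \<beta>'_def)
    next
      case False
      have "chatter lam N (\<alpha> i) t \<le> chatter lam N (\<beta> i) t"
        using ad i by (intro C.chatter_mono ctrl_\<alpha> ctrl_\<beta> t) (auto simp: admissible_def)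
      then show ?thesis using False i by (simp add: \<alpha>'_def \<beta>'_def)
    qed
    show "0 \<le> \<beta>' i t" "\<beta>' i t \<le> lam t"
      using C.chatter_bounds[OF t] by (simp_all add: \<beta>'_def)
  qed (use C.lam_meas C.chatter_meas \<alpha>'_meas in \<open>simp_all add: \<beta>'_def\<close>)
  have \<alpha>'_integral: "integral {0..1} (\<alpha>' i) = integral {0..1} (\<alpha> i)" if "i \<le> m" for i
  proof -
    consider "i = 0" | "i = m" "i \<noteq> 0" | "i \<noteq> 0" "i \<noteq> m" by blast
    then show ?thesis
    proof cases
      case 1
      then show ?thesis using \<alpha>0 by (intro integral_cong) (simp add: \<alpha>'_def)
    next
      case 2
      then show ?thesis using \<alpha>m by (intro integral_cong) (simp add: \<alpha>'_def)
    next
      case 3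
      then show ?thesis using C.chatter_integral[OF ctrl_\<alpha>[OF that]] by (simp add: \<alpha>'_def)
    qed
  qed
  interpret R': rates K M "\<lambda>k. \<beta>' (switch_index m s k)"
    by (rule admissible_rates[OF ad' s K M])
  obtain x' where cas': "cascade K M (\<lambda>k. \<beta>' (switch_index m s k)) x'"
    using R'.cascade_exists by blast
  interpret B: cascade K M "\<lambda>k. \<beta>' (switch_index m s k)" x' by fact

  define \<delta> where "\<delta> = M * (M + 1) / N"
  have "0 \<le> \<delta>" using M by (simp add: \<delta>_def)
  have weak: "\<bar>integral {0..t} (\<lambda>u. (f u - chatter lam N f u) * x k u)\<bar> \<le> \<delta>"
    if "C.control f" "k \<in> {1..K}" "t \<in> {0..1}" for f k t
    unfolding \<delta>_def
  proof (rule C.chatter_close[OF that(1) A.x_meas[OF that(2)] _ M _ that(3)])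
    show "\<bar>x k u\<bar> \<le> 1" if "u \<in> {0..1}" for u
      using A.x_nonneg[OF \<open>k \<in> {1..K}\<close> that] A.x_le_1[OF \<open>k \<in> {1..K}\<close> that] by simp
  qed (rule A.x_lipschitz[OF that(2)])
  have idx: "switch_index m s k \<in> {1..m}" if "k \<in> {1..K}" for k
    using switch_index_spec[OF s that] by blast
  have x_close: "\<bar>x k t - x' k t\<bar> \<le> R * \<delta>" if "k \<in> {1..K}" "t \<in> {0..1}" for k t
    unfolding R_def
  proof (rule cascade_stability[OF cas cas' \<open>0 \<le> \<delta>\<close> _ that])
    fix k and t :: real assume "k \<in> {1..K}" "t \<in> {0..1}"
    then show "\<bar>integral {0..t} (\<lambda>u. (\<beta> (switch_index m s k) u - \<beta>' (switch_index m s k) u) * x k u)\<bar> \<le> \<delta>"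
      unfolding \<beta>'_def by (intro weak ctrl_\<beta> idx)
  qed
  have product_close: "integral {0..1} (\<lambda>t. f' t * x' k t) \<le> integral {0..1} (\<lambda>t. f t * x k t) + (\<delta> + M * (R * \<delta>))"
    if k: "k \<in> {1..K}" and f: "bdd_meas f" and f': "bdd_meas f'"
      and f'_bounds: "\<And>t. t \<in> {0..1} \<Longrightarrow> 0 \<le> f' t \<and> f' t \<le> lam t"
      and wk: "\<bar>integral {0..1} (\<lambda>t. (f t - f' t) * x k t)\<bar> \<le> \<delta>" for k f f'
  proof -
    let ?u = "\<lambda>t. f t * x k t" and ?v = "\<lambda>t. (f t - f' t) * x k t" and ?w = "\<lambda>t. f' t * (x k t - x' k t)"
    have meas: "bdd_meas ?u" "bdd_meas ?v" "bdd_meas ?w"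
      using k by (intro bdd_meas_mult bdd_meas_diff f f' A.x_meas B.x_meas; assumption)+
    have "integral {0..1} (\<lambda>t. f' t * x' k t) = integral {0..1} (\<lambda>t. ?u t - ?v t - ?w t)"
      by (simp add: algebra_simps)
    also have "\<dots> = integral {0..1} ?u - integral {0..1} ?v - integral {0..1} ?w"
      using meas by (simp add: integral_diff bdd_meas_integrable bdd_meas_diff)
    finally have eq: "integral {0..1} (\<lambda>t. f' t * x' k t)
        = integral {0..1} ?u - integral {0..1} ?v - integral {0..1} ?w" .
    have "\<bar>integral {0..1} ?w\<bar> \<le> (M * (R * \<delta>)) * (1 - 0)"
    proof (rule bdd_meas_integral_abs_le[OF meas(3)])
      fix t :: real assume t: "t \<in> {0..1}"
      have "\<bar>f' t\<bar> \<le> M" using f'_bounds[OF t] C.lam_bounds[OF t] by linarith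
      then show "\<bar>?w t\<bar> \<le> M * (R * \<delta>)"
        unfolding abs_mult using M x_close[OF k t] by (intro mult_mono) auto
    qed auto
    then have w_le: "\<bar>integral {0..1} ?w\<bar> \<le> M * (R * \<delta>)" by simp
    show ?thesis using eq w_le wk by linarith
  qed

  have G_eq: "G / N = K * (\<delta> + (M + 1) * (R * \<delta>))"
    by (simp add: G_def \<delta>_def algebra_simps add_divide_distrib)
  have "0 \<le> R * \<delta>" using \<open>0 \<le> R\<close> \<open>0 \<le> \<delta>\<close> by simp
  have tails': "(\<Sum>k = s (i + 1) + 1..K. x' k 1) \<le> (\<theta> + \<epsilon>) * P i" if i: "i \<in> {1..m}" for i
  proof -
    have "(\<Sum>k = s (i + 1) + 1..K. x' k 1) \<le> (\<Sum>k = s (i + 1) + 1..K. x k 1 + R * \<delta>)"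
    proof (rule sum_mono)
      fix k assume "k \<in> {s (i + 1) + 1..K}"
      then have "\<bar>x k 1 - x' k 1\<bar> \<le> R * \<delta>" by (intro x_close) auto
      then show "x' k 1 \<le> x k 1 + R * \<delta>" by linarith
    qed
    also have "\<dots> = (\<Sum>k = s (i + 1) + 1..K. x k 1) + real (K - s (i + 1)) * (R * \<delta>)"
      by (simp add: sum.distrib)
    also have "\<dots> \<le> \<theta> * P i + real K * (\<delta> + (M + 1) * (R * \<delta>))"
    proof (intro add_mono tails[OF i] mult_mono)
      have "0 \<le> M * (R * \<delta>)" using M \<open>0 \<le> R * \<delta>\<close> by simp
      then show "R * \<delta> \<le> \<delta> + (M + 1) * (R * \<delta>)"
        using \<open>0 \<le> \<delta>\<close> by (simp add: distrib_right)
    qed (use \<open>0 \<le> R * \<delta>\<close> in auto)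
    also have "\<dots> \<le> (\<theta> + \<epsilon>) * P i"
      using N(2)[OF i] unfolding G_eq by (simp add: distrib_right)
    finally show ?thesis .
  qed
  have loads': "load K m s \<alpha>' \<beta>' x' i \<le> (\<theta> + \<epsilon>) * E i" if i: "i \<in> {0..m - 1}" for i
  proof (cases "integral {0..1} (\<alpha> i) = 0")
    case True
    have "i < m" using i m by auto
    \<comment> \<open>Here the Poisson factor is zero, so no increase of \<open>\<theta>\<close> helps; but every rate occurring in the
      load is dominated by \<open>\<alpha>' i\<close>, which has integral zero.\<close>
    have zero: "integral {0..1} (\<lambda>t. f t * x' k t) \<le> 0"
      if f: "bdd_meas f" "\<And>t. t \<in> {0..1} \<Longrightarrow> 0 \<le> f t \<and> f t \<le> \<alpha>' i t" and k: "k \<in> {1..K}" for f k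
    proof -
      have "integral {0..1} (\<lambda>t. f t * x' k t) \<le> integral {0..1} (\<alpha>' i)"
      proof (intro integral_le bdd_meas_integrable bdd_meas_mult f(1) B.x_meas[OF k] \<alpha>'_meas)
        fix t :: real assume t: "t \<in> {0..1}"
        have "f t * x' k t \<le> \<alpha>' i t * 1"
          using f(2)[OF t] B.x_nonneg[OF k t] B.x_le_1[OF k t] by (intro mult_mono) auto
        then show "f t * x' k t \<le> \<alpha>' i t" by simp
      qed auto
      with True \<alpha>'_integral[of i] \<open>i < m\<close> show ?thesis by simp
    qed
    have "load K m s \<alpha>' \<beta>' x' i \<le> 0"
      unfolding load_def
    proof (intro add_nonpos_nonpos sum_nonpos zero \<alpha>'_meas)
      fix k assume k: "k \<in> {1..s (i + 1)}"
      have kK: "k \<in> {1..K}"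
        using k switching_vector_less(2)[OF s \<open>i < m\<close>] by auto
      then show "k \<in> {1..K}" "bdd_meas (\<beta>' (switch_index m s k))"
        by (auto intro: R'.b_meas)
      fix t :: real assume t: "t \<in> {0..1}"
      have "\<beta>' (switch_index m s k) t \<le> \<beta>' (i + 1) t"
        using switch_index_ge[OF s \<open>i < m\<close> k] by (intro admissible_beta_antimono[OF ad'] t) auto
      also have "\<dots> \<le> \<alpha>' i t"
        using ad' t i by (simp add: admissible_def)
      finally show "0 \<le> \<beta>' (switch_index m s k) t \<and> \<beta>' (switch_index m s k) t \<le> \<alpha>' i t"
        using R'.b_bounds[OF kK t] by simp
    qed (use \<alpha>'_bounds in auto)
    moreover have "E i = 0"
      by (simp add: E_def True Pois_def)
    ultimately show ?thesis by simp
  next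
    case False
    have "i < m" using i m by auto
    define e where "e = \<delta> + M * (R * \<delta>)"
    have sK: "s (i + 1) \<le> K"
      by (rule switching_vector_less(2)[OF s \<open>i < m\<close>])
    have "load K m s \<alpha>' \<beta>' x' i
        \<le> (\<Sum>k = 1..s (i + 1). integral {0..1} (\<lambda>t. \<beta> (switch_index m s k) t * x k t) + e)
          + (\<Sum>k = s (i + 1) + 1..K. integral {0..1} (\<lambda>t. \<alpha> i t * x k t) + e)"
      unfolding load_def e_def
    proof (intro add_mono sum_mono product_close)
      fix k assume "k \<in> {1..s (i + 1)}"
      then have k: "k \<in> {1..K}" using sK by auto
      show "k \<in> {1..K}" "bdd_meas (\<beta> (switch_index m s k))" "bdd_meas (\<beta>' (switch_index m s k))"
        using k A.b_meas R'.b_meas by blast+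
      show "0 \<le> \<beta>' (switch_index m s k) t \<and> \<beta>' (switch_index m s k) t \<le> lam t" if "t \<in> {0..1}" for t
        unfolding \<beta>'_def by (rule C.chatter_bounds[OF that])
      show "\<bar>integral {0..1} (\<lambda>t. (\<beta> (switch_index m s k) t - \<beta>' (switch_index m s k) t) * x k t)\<bar> \<le> \<delta>"
        unfolding \<beta>'_def by (intro weak ctrl_\<beta> idx k) auto
    next
      fix k assume "k \<in> {s (i + 1) + 1..K}"
      then show k: "k \<in> {1..K}" by auto
      show "bdd_meas (\<alpha> i)" using \<open>i < m\<close> by (intro \<alpha>_meas) simp
      show "\<bar>integral {0..1} (\<lambda>t. (\<alpha> i t - \<alpha>' i t) * x k t)\<bar> \<le> \<delta>"
      proof (cases "i = 0")
        case True
        then have "integral {0..1} (\<lambda>t. (\<alpha> i t - \<alpha>' i t) * x k t) = integral {0..1} (\<lambda>t::real. 0::real)"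
          using \<alpha>0 by (intro integral_cong) (simp add: \<alpha>'_def)
        then show ?thesis using \<open>0 \<le> \<delta>\<close> by simp
      next
        case False
        then have "\<alpha>' i = chatter lam N (\<alpha> i)" using \<open>i < m\<close> by (simp add: \<alpha>'_def)
        then show ?thesis
          using weak[OF ctrl_\<alpha> k, of i 1] \<open>i < m\<close> by simp
      qed
    qed (use \<alpha>'_meas \<alpha>'_bounds in auto)
    also have "\<dots> = load K m s \<alpha> \<beta> x i + (real (s (i + 1)) * e + real (K - s (i + 1)) * e)"
      by (simp add: load_def sum.distrib)
    also have "real (s (i + 1)) * e + real (K - s (i + 1)) * e = real K * e"
      using sK by (simp add: of_nat_diff algebra_simps)
    also have "load K m s \<alpha> \<beta> x i + real K * e \<le> \<theta> * E i + real K * (\<delta> + (M + 1) * (R * \<delta>))"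
    proof (intro add_mono loads[OF i] mult_left_mono)
      show "e \<le> \<delta> + (M + 1) * (R * \<delta>)"
        using \<open>0 \<le> R * \<delta>\<close> by (simp add: e_def distrib_right)
    qed simp
    also have "\<dots> \<le> (\<theta> + \<epsilon>) * E i"
      using N(3)[OF i False] unfolding G_eq by (simp add: distrib_right)
    finally show ?thesis .
  qed

  have P': "measure_pmf.prob (Pois (integral {0..1} (\<alpha>' i))) {..K - 1} = P i" if "i \<in> {1..m}" for i
    using \<alpha>'_integral[of i] that by (simp add: P_def)
  have E': "measure_pmf.expectation (Pois (integral {0..1} (\<alpha>' i))) (\<lambda>n. real (min n K)) = E i"
    if "i \<in> {0..m - 1}" for i
    using \<alpha>'_integral[of i] that m by (simp add: E_def)
  have "feasible K m s M (\<theta> + \<epsilon>) lam \<alpha>' \<beta>'"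
    unfolding iff
  proof (intro conjI exI[of _ x'] ballI ad' cas')
    fix i assume i: "i \<in> {1..m}"
    show "(\<Sum>k = s (i + 1) + 1..K. x' k 1)
        \<le> (\<theta> + \<epsilon>) * measure_pmf.prob (Pois (integral {0..1} (\<alpha>' i))) {..K - 1}"
      unfolding P'[OF i] by (rule tails'[OF i])
  next
    fix i assume i: "i \<in> {0..m - 1}"
    show "load K m s \<alpha>' \<beta>' x' i
        \<le> (\<theta> + \<epsilon>) * measure_pmf.expectation (Pois (integral {0..1} (\<alpha>' i))) (\<lambda>n. real (min n K))"
      unfolding E'[OF i] by (rule loads'[OF i])
  qed
  then show thesis
  proof (rule that, intro ballI)
    fix t :: real assume t: "t \<in> {0..1}"
    have nested: "t \<in> bursts lam N (\<beta> i)" if "1 \<le> i" "i \<le> j" "j \<le> m" "t \<in> bursts lam N (\<beta> j)" for i j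
    proof -
      have "bursts lam N (\<beta> j) \<subseteq> bursts lam N (\<beta> i)"
        using that by (intro C.bursts_mono ctrl_\<beta> admissible_beta_antimono[OF ad]) auto
      with that(4) show ?thesis by blast
    qed
    obtain r where r: "r \<in> {1..m + 1}" "\<And>i. i \<in> {1..m} \<Longrightarrow> t \<in> bursts lam N (\<beta> i) \<longleftrightarrow> i < r"
      using threshold_of_antimono[of m "\<lambda>i. t \<in> bursts lam N (\<beta> i)"] nested by metis
    show "\<exists>r\<in>{1..m + 1}. \<forall>i\<in>{1..m}. (r \<le> i \<longrightarrow> \<beta>' i t = 0) \<and> (i < r \<longrightarrow> \<beta>' i t = lam t)"
      by (rule bexI[OF _ r(1)]) (simp add: \<beta>'_def chatter_def r(2))
  qed
qed

section \<open>Late switching in feasible solutions\<close>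

text \<open>
  Only the \<open>\<alpha>\<^sup>i\<close> with \<open>0 < i < m\<close> change. Their integrals, hence the Poisson terms, are kept, and the second
  sum of the right-hand side equals \<open>\<integral>\<alpha>\<^sup>i X\<close> for the nonincreasing tail sum \<open>X\<close>.
\<close>

lemma feasible_late_switching:
  assumes m: "1 \<le> m" and K: "1 \<le> K" and M: "0 \<le> M" and s: "switching_vector K m s"
    and feas: "feasible K m s M \<theta> lam \<alpha> \<beta>"
  obtains \<alpha>' where "feasible K m s M \<theta> lam \<alpha>' \<beta>"
    "\<forall>i\<in>{1..m - 1}. \<exists>w\<in>{0..1}.
       (\<forall>t\<in>{0..w}. \<alpha>' i t = \<beta> (i + 1) t) \<and> (\<forall>t\<in>{w<..1}. \<alpha>' i t = \<beta> i t)"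
proof -
  note iff = feasible_iff_cascade[OF m K M s]
  obtain x where ad: "admissible m M lam \<alpha> \<beta>"
    and cas: "cascade K M (\<lambda>k. \<beta> (switch_index m s k)) x"
    and tails: "\<And>i. i \<in> {1..m} \<Longrightarrow> (\<Sum>k = s (i + 1) + 1..K. x k 1)
          \<le> \<theta> * measure_pmf.prob (Pois (integral {0..1} (\<alpha> i))) {..K - 1}"
    and loads: "\<And>i. i \<in> {0..m - 1} \<Longrightarrow> load K m s \<alpha> \<beta> x i
          \<le> \<theta> * measure_pmf.expectation (Pois (integral {0..1} (\<alpha> i))) (\<lambda>n. real (min n K))"
    using feas unfolding iff by blast
  interpret cascade K M "\<lambda>k. \<beta> (switch_index m s k)" x by fact
  have sandwich: "\<beta> (i + 1) t \<le> \<alpha> i t \<and> \<alpha> i t \<le> \<beta> i t" if "i \<in> {1..m - 1}" "t \<in> {0..1}" for i t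
    using ad that by (auto simp: admissible_def)
  have meas: "bdd_meas (\<beta> (i + 1))" "bdd_meas (\<alpha> i)" "bdd_meas (\<beta> i)" if "i \<in> {1..m - 1}" for i
    using ad that by (auto simp: admissible_def)
  define good where "good = (\<lambda>i w. w \<in> {0..1} \<and>
      integral {0..1} (\<lambda>t. if t \<le> w then \<beta> (i + 1) t else \<beta> i t) = integral {0..1} (\<alpha> i) \<and>
      (\<forall>X. bdd_meas X \<longrightarrow> antimono_on {0..1} X \<longrightarrow>
        integral {0..1} (\<lambda>t. (if t \<le> w then \<beta> (i + 1) t else \<beta> i t) * X t)
          \<le> integral {0..1} (\<lambda>t. \<alpha> i t * X t)))"
  have "\<exists>w. good i w" if i: "i \<in> {1..m - 1}" for i
    by (rule late_switch_optimal[OF meas[OF i] sandwich[OF i]]) (auto simp: good_def)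
  then obtain w where "\<And>i. i \<in> {1..m - 1} \<Longrightarrow> good i (w i)"
    by metis
  then have w: "\<And>i. i \<in> {1..m - 1} \<Longrightarrow> w i \<in> {0..1}"
    "\<And>i. i \<in> {1..m - 1} \<Longrightarrow>
      integral {0..1} (\<lambda>t. if t \<le> w i then \<beta> (i + 1) t else \<beta> i t) = integral {0..1} (\<alpha> i)"
    "\<And>i X. i \<in> {1..m - 1} \<Longrightarrow> bdd_meas X \<Longrightarrow> antimono_on {0..1} X \<Longrightarrow>
      integral {0..1} (\<lambda>t. (if t \<le> w i then \<beta> (i + 1) t else \<beta> i t) * X t)
        \<le> integral {0..1} (\<lambda>t. \<alpha> i t * X t)"
    unfolding good_def by blast+
  define \<alpha>' where "\<alpha>' = (\<lambda>i. if i \<in> {1..m - 1}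
      then (\<lambda>t. if t \<le> w i then \<beta> (i + 1) t else \<beta> i t) else \<alpha> i)"
  have \<alpha>'_in: "\<alpha>' i = (\<lambda>t. if t \<le> w i then \<beta> (i + 1) t else \<beta> i t)" if "i \<in> {1..m - 1}" for i
    using that by (simp add: \<alpha>'_def)
  have \<alpha>'_out: "\<alpha>' i = \<alpha> i" if "i \<notin> {1..m - 1}" for i
    using that unfolding \<alpha>'_def by (simp only: if_False)
  have \<alpha>'_meas: "bdd_meas (\<alpha>' i)" if "i \<in> {0..m}" for i
  proof (cases "i \<in> {1..m - 1}")
    case True
    from bdd_meas_if[OF meas(1,3)[OF True], of "{..w i}"] show ?thesis
      by (simp add: \<alpha>'_in[OF True])
  next
    case False
    then show ?thesis using \<alpha>'_out ad that by (simp add: admissible_def)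
  qed
  have ad': "admissible m M lam \<alpha>' \<beta>"
    unfolding admissible_def
  proof (intro conjI ballI)
    fix t :: real assume t: "t \<in> {0..1}"
    show "\<alpha>' m t = 0" "\<alpha>' 0 t = lam t"
      using ad t m \<alpha>'_out[of m] \<alpha>'_out[of 0] by (auto simp: admissible_def)
    show "lam t \<le> M" using ad t by (simp add: admissible_def)
    fix i
    show "\<beta> (i + 1) t \<le> \<alpha>' i t" if "i \<in> {0..m - 1}"
    proof (cases "i \<in> {1..m - 1}")
      case True
      then show ?thesis
        using sandwich[OF True t] by (simp add: \<alpha>'_in[OF True])
    next
      case False
      with \<alpha>'_out[OF False] ad t that show ?thesis by (simp add: admissible_def)
    qed
    assume i: "i \<in> {1..m}"
    show "\<alpha>' i t \<le> \<beta> i t"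
    proof (cases "i \<in> {1..m - 1}")
      case True
      then show ?thesis
        using sandwich[OF True t] by (simp add: \<alpha>'_in[OF True])
    next
      case False
      with \<alpha>'_out[OF False] ad t i show ?thesis by (simp add: admissible_def)
    qed
    show "0 \<le> \<beta> i t" "\<beta> i t \<le> lam t"
      using ad t i by (auto simp: admissible_def)
  qed (use ad \<alpha>'_meas in \<open>auto simp: admissible_def\<close>)
  have same_integral: "integral {0..1} (\<alpha>' i) = integral {0..1} (\<alpha> i)" for i
  proof (cases "i \<in> {1..m - 1}")
    case True
    then show ?thesis unfolding \<alpha>'_in[OF True] by (rule w(2))
  next
    case False
    then show ?thesis by (simp only: \<alpha>'_out[OF False])
  qed
  have loads': "load K m s \<alpha>' \<beta> x i \<le> load K m s \<alpha> \<beta> x i" if "i \<in> {0..m - 1}" for i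
  proof (cases "i \<in> {1..m - 1}")
    case True
    let ?X = "\<lambda>t. \<Sum>k = s (i + 1) + 1..K. x k t"
    have "i < m" using True by auto
    then have "s (i - 1 + 1 + 1) < K"
      by (intro switching_vector_less(1)[OF s]) simp
    then have start: "s (i + 1) + 1 \<in> {1..K}"
      using True by simp
    have X: "bdd_meas ?X"
      by (intro bdd_meas_sum x_meas) auto
    have split: "(\<Sum>k = s (i + 1) + 1..K. integral {0..1} (\<lambda>t. f t * x k t))
        = integral {0..1} (\<lambda>t. f t * ?X t)" if "bdd_meas f" for f
      using that unfolding sum_distrib_left
      by (intro integral_sum[symmetric] bdd_meas_integrable bdd_meas_mult x_meas) auto
    have "integral {0..1} (\<lambda>t. \<alpha>' i t * ?X t) \<le> integral {0..1} (\<lambda>t. \<alpha> i t * ?X t)"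
      unfolding \<alpha>'_in[OF True] by (intro w(3)[OF True] X monotone_onI tail_antimono start) auto
    with True show ?thesis
      using split[OF \<alpha>'_meas, of i] split[OF meas(2)[OF True]] \<open>i < m\<close> by (simp add: load_def)
  next
    case False
    then show ?thesis by (simp add: load_def \<alpha>'_out[OF False])
  qed
  have "feasible K m s M \<theta> lam \<alpha>' \<beta>"
    unfolding iff same_integral
    by (intro conjI exI[of _ x] ballI ad' cas tails order_trans[OF loads' loads])
  then show thesis
  proof (rule that, intro ballI)
    fix i assume i: "i \<in> {1..m - 1}"
    show "\<exists>w\<in>{0..1}. (\<forall>t\<in>{0..w}. \<alpha>' i t = \<beta> (i + 1) t) \<and> (\<forall>t\<in>{w<..1}. \<alpha>' i t = \<beta> i t)"
      by (rule bexI[OF _ w(1)[OF i]]) (simp add: \<alpha>'_in[OF i])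
  qed
qed

section \<open>Near-optimal structured solutions\<close>

text \<open>
  The infimum is thus taken over a nonempty set, so that it is approached by feasible values.
\<close>

lemma feasible_zero:
  assumes m: "1 \<le> m" and K: "1 \<le> K" and M: "0 \<le> M" and s: "switching_vector K m s"
  shows "feasible K m s M 1 (\<lambda>_. 0) (\<lambda>_ _. 0) (\<lambda>_ _. 0)"
proof -
  have ad: "admissible m M (\<lambda>_. 0) (\<lambda>_ _. 0) (\<lambda>_ _. 0)"
    using M by (simp add: admissible_def)
  interpret rates K M "\<lambda>_ _. 0"
    using admissible_rates[OF ad s K M] .
  obtain x where cas: "cascade K M (\<lambda>_ _. 0) x"
    using cascade_exists by blast
  interpret cascade K M "\<lambda>_ _. 0" x by fact
  have out: "outflow K (\<lambda>_ _. 0) x j = (\<lambda>_. 0)" for j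
    by (auto simp: outflow_def)
  have tail: "(\<Sum>k = s (i + 1) + 1..K. x k 1) = 1" if "i \<in> {1..m}" for i
  proof -
    have "s (i - 1 + 1 + 1) < K"
      using that by (intro switching_vector_less(1)[OF s]) auto
    then have "s (i + 1) + 1 \<in> {1..K}"
      using that by simp
    from tail_eq[OF this, of 1] show ?thesis by (simp add: out)
  qed
  have "measure_pmf.prob (return_pmf (0::nat)) {..K - 1} = 1"
    by (simp add: measure_return_pmf)
  then show ?thesis
    unfolding feasible_iff_cascade[OF m K M s] using ad cas tail
    by (intro conjI exI[of _ x]) (simp_all add: Pois_def load_def)
qed

theorem theorem2:
  fixes K m :: nat and s :: "nat \<Rightarrow> nat" and M \<epsilon> :: real
  assumes "1 \<le> m" and "m \<le> K" and "0 < M"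
    and "switching_vector K m s"
    and "0 < \<epsilon>"
  shows "\<exists>\<theta> lam \<alpha> \<beta>.
    feasible K m s M \<theta> lam \<alpha> \<beta> \<and>
    \<theta> \<le> PoisOPTRe K m s M + \<epsilon> \<and>
    (\<forall>i\<in>{1..m - 1}. \<exists>w\<in>{0..1}.
       (\<forall>t\<in>{0..w}. \<alpha> i t = \<beta> (i + 1) t) \<and> (\<forall>t\<in>{w<..1}. \<alpha> i t = \<beta> i t)) \<and>
    (\<forall>t\<in>{0..1}. \<exists>r\<in>{1..m + 1}. \<forall>i\<in>{1..m}.
       (r \<le> i \<longrightarrow> \<beta> i t = 0) \<and> (i < r \<longrightarrow> \<beta> i t = lam t))"
proof -
  have m: "1 \<le> m" and K: "1 \<le> K" and M: "0 \<le> M" and s: "switching_vector K m s"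
    and e: "0 < \<epsilon> / 2"
    using assms by simp_all
  let ?V = "{\<theta>. \<exists>lam \<alpha> \<beta>. feasible K m s M \<theta> lam \<alpha> \<beta>}"
  have "?V \<noteq> {}"
    using feasible_zero[OF m K M s] by blast
  moreover have "Inf ?V < PoisOPTRe K m s M + \<epsilon> / 2"
    using e by (simp add: PoisOPTRe_def)
  ultimately have "\<exists>\<theta>\<in>?V. \<theta> < PoisOPTRe K m s M + \<epsilon> / 2"
    by (rule cInf_lessD)
  then obtain \<theta> where \<theta>: "\<theta> \<in> ?V" "\<theta> < PoisOPTRe K m s M + \<epsilon> / 2"
    by blast
  from \<theta>(1) obtain lam \<alpha> \<beta> where feas: "feasible K m s M \<theta> lam \<alpha> \<beta>"
    by blast
  obtain \<alpha>1 \<beta>' where bang: "feasible K m s M (\<theta> + \<epsilon> / 2) lam \<alpha>1 \<beta>'"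
    and r: "\<forall>t\<in>{0..1}. \<exists>r\<in>{1..m + 1}. \<forall>i\<in>{1..m}.
       (r \<le> i \<longrightarrow> \<beta>' i t = 0) \<and> (i < r \<longrightarrow> \<beta>' i t = lam t)"
    by (rule feasible_bang_bang[OF m K M s feas e])
  obtain \<alpha>' where late: "feasible K m s M (\<theta> + \<epsilon> / 2) lam \<alpha>' \<beta>'"
    and w: "\<forall>i\<in>{1..m - 1}. \<exists>w\<in>{0..1}.
       (\<forall>t\<in>{0..w}. \<alpha>' i t = \<beta>' (i + 1) t) \<and> (\<forall>t\<in>{w<..1}. \<alpha>' i t = \<beta>' i t)"
    by (rule feasible_late_switching[OF m K M s bang])
  have near: "\<theta> + \<epsilon> / 2 \<le> PoisOPTRe K m s M + \<epsilon>"
    using \<theta>(2) by simp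
  show ?thesis
    by (rule exI)+ (rule conjI[OF late conjI[OF near conjI[OF w r]]])
qed

end
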